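(* Let $V=2\,\mathrm{Im}(\mathrm{Li}_2(e^{\pi i/3}))=2.0298832\ldots$ (the volume of the $4_1$ knot), $C=V/(2\pi)$, and $\mathsf{e}(x)=e^{2\pi i x}$. Take $M=N=1$, $(A,B)=(1,2)$ and $\lambda<0$ a real number near zero. Then $g(z)=-z(1-z)^{-2}$, the set $\mathcal{S}=\{w\in\mathbb{C}: g(e^{2\pi w})=1,\ 0<\mathrm{Im}(w)-\lambda<1\}$ equals $\{i/6,\,5i/6\}$, the corresponding values $z=e^{2\pi w}$ are $z_\pm=\mathsf{e}(\pm 1/6)$ (with $z_+$ for $w=i/6$ and $z_-$ for $w=5i/6$), and $$e^{\pi i\frac{B+3A-6}{12}}=\mathsf{e}\left(-\tfrac{1}{24}\right),\qquad e^{\frac{iB}{2\pi}R(z_+)}=e^{-C}\,\mathsf{e}\left(-\tfrac1{24}\right),\qquad e^{\frac{iB}{2\pi}R(z_-)}=-e^{C}\,\mathsf{e}\left(-\tfrac1{24}\right)\mathsf{e}\left(\tfrac13\right),$$ $$\frac{(1-z_\pm)^{B/4}}{A+Bz_\pm/(1-z_\pm)}=\frac{1}{\sqrt3}\,\mathsf{e}\left(\mp\tfrac13\right).$$ Consequently, $$ \mathcal{I}_{1,2}(1)=\int_{\mathbb{R}+i\epsilon}\Phi_1(x)^2e^{-\pi i x^2}\,dx= \frac{e^{\pi i/6}}{\sqrt{3}} \left(e^{\frac{V}{2\pi}}-e^{-\frac{V}{2\pi}}\right). $$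
   Context: Faddeev's quantum dilogarithm at $\mathsf{b}=1$ is the meromorphic function $\Phi_1$ on $\mathbb{C}$ given for $|\mathrm{Im}\,x|<1$ by $\Phi_1(x)=\exp\left(\int_{\mathbb{R}+i\epsilon}\frac{e^{-2ixt}}{4\sinh(t)^2}\frac{dt}{t}\right)$ with small $\epsilon>0$. In the integral defining $\mathcal{I}_{1,2}(1)$, $\epsilon>0$ is small (the integral converges absolutely). In general $g(z)=(-z)^A(1-z)^{-B}$. $\mathrm{Li}_2(z)=\sum_{n\ge1}z^n/n^2$ for $|z|\le 1$. The Rogers dilogarithm is $R(z)=\mathrm{Li}_2(z)+\frac12\log(z)\log(1-z)-\frac{\pi^2}{6}$, where the branches $\log z_+=2\pi i/6$ and $\log z_-=10\pi i/6$ are used, and $\log(1-z_\pm)$ and the power $(1-z_\pm)^{B/4}$ are taken with the principal branch. *)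

theory Defs
  imports "HOL-Complex_Analysis.Complex_Analysis"
begin

definition ee :: "complex \<Rightarrow> complex"
  where "ee x = exp (2 * of_real pi * \<i> * x)"

text \<open>The contour $\mathbb{R} + i\epsilon$, oriented from left to right.\<close>

definition shifted_line_integrable :: "real \<Rightarrow> (complex \<Rightarrow> complex) \<Rightarrow> bool"
  where "shifted_line_integrable \<epsilon> f \<longleftrightarrow>
    integrable lborel (\<lambda>t::real. f (of_real t + \<i> * of_real \<epsilon>))"

definition shifted_line_integral :: "real \<Rightarrow> (complex \<Rightarrow> complex) \<Rightarrow> complex"
  where "shifted_line_integral \<epsilon> f = (LINT t|lborel. f (of_real t + \<i> * of_real \<epsilon>))"

text \<open>
  Meromorphic functions are total functions here. The normalisation of
  \<^const>\<open>nicely_meromorphic_on\<close> (value \<open>0\<close> at the poles, no removable singularities) makes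
  the function described below unique. For \<open>0 < \<epsilon> < \<pi>\<close> the contour
  separates the pole of the integrand at \<open>0\<close> from those in the upper half plane, so the
  integral is independent of such \<open>\<epsilon>\<close>.
\<close>

definition is_faddeev_Phi1 :: "(complex \<Rightarrow> complex) \<Rightarrow> bool"
  where "is_faddeev_Phi1 f \<longleftrightarrow>
    f nicely_meromorphic_on UNIV \<and>
    (\<forall>\<^sub>F \<epsilon> in at_right 0. \<forall>x. \<bar>Im x\<bar> < 1 \<longrightarrow>
       f x = exp (shifted_line_integral \<epsilon> (\<lambda>t. exp (- 2 * \<i> * x * t) / (4 * sinh t ^ 2) * (1 / t))))"

definition Phi1 :: "complex \<Rightarrow> complex"
  where "Phi1 = (SOME f. is_faddeev_Phi1 f)"

definition gAB :: "int \<Rightarrow> int \<Rightarrow> complex \<Rightarrow> complex"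
  where "gAB A B z = (- z) powi A * (1 - z) powi (- B)"

text \<open>Only meaningful for \<open>\<bar>z\<bar> \<le> 1\<close>, where the series converges.\<close>

definition Li2 :: "complex \<Rightarrow> complex"
  where "Li2 z = (\<Sum>n. z ^ Suc n / of_nat (Suc n) ^ 2)"

text \<open>
  The Rogers dilogarithm at \<open>z\<close> for a chosen value \<open>l\<close> of \<open>log z\<close>; the logarithm of
  \<open>1 - z\<close> is principal.
\<close>

definition Rogers :: "complex \<Rightarrow> complex \<Rightarrow> complex"
  where "Rogers l z = Li2 z + 1 / 2 * l * Ln (1 - z) - of_real (pi ^ 2) / 6"

end

theory Submission
  imports Defs
begin

text \<open>
  Write \<open>F(x) = Phi1(x)^2 exp(- \<pi> \<i> x^2)\<close> for the integrand.  The evaluation rests on a quasi-periodicity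
  of \<open>F\<close>: for \<open>0 < Im x < 1\<close> one has \<open>F(x - \<i>) = (2 - 2 cosh(2 \<pi> x)) F(x)\<close>, and the factor
  is itself \<open>\<i>\<close>-periodic.  Hence \<open>F(x) = K(x) - K(x - \<i>)\<close> with \<open>K = F / (2 cosh(2 \<pi> x) - 1)\<close>, so
  the integral of \<open>F\<close> over \<open>Im x = \<epsilon>\<close> is the difference of the integrals of \<open>K\<close> over \<open>Im x = \<epsilon>\<close> and
  \<open>Im x = \<epsilon> - 1\<close>.  Between these lines \<open>K\<close> has only the simple poles \<open>- \<i>/6\<close> and \<open>- 5\<i>/6\<close>, and the
  residue theorem in a strip (\<open>strip_residue_theorem\<close>) leaves
  \<open>(F(- \<i>/6) - F(- 5\<i>/6)) / sqrt 3\<close> (\<open>integral41_residues\<close>).  Shifting downwards rather than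
  upwards keeps both lines inside \<open>|Im x| < 1\<close>, where \<open>Phi1\<close> is given by its integral.

  What has to be known about \<open>Phi1 = exp log_Phi1\<close> comes from one differential equation.  The
  derivative of \<open>log_Phi1\<close> is a Fourier integral of \<open>1 / sinh(t)^2\<close>; moving its contour by \<open>- \<pi> \<i>\<close>
  multiplies the integrand by \<open>exp(- 2 \<pi> x)\<close> and crosses one double pole, whence
  \<open>log_Phi1' x = - 2 \<pi> \<i> x / (exp(- 2 \<pi> x) - 1)\<close> (\<open>log_Phi_has_field_derivative\<close>).  Moreover
  \<open>log_Phi1\<close> tends to \<open>0\<close> as \<open>Re x\<close> tends to minus infinity.  Comparing derivatives and limits gives

    \<^item> independence of the contour height \<open>\<epsilon>\<close>;
    \<^item> the functional equation \<open>Phi1(x - \<i>) = (1 - exp(2 \<pi> x)) Phi1(x)\<close>, which yields the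
      quasi-periodicity of \<open>F\<close> and also continues \<open>Phi1\<close> meromorphically to the plane, so that the
      description of \<open>Phi1\<close> is satisfiable;
    \<^item> the inversion formula \<open>log_Phi1 x + log_Phi1 (- x) = \<pi> \<i> x^2 + \<pi> \<i> / 6\<close>, which controls \<open>F\<close>
      for large positive \<open>Re x\<close>;
    \<^item> the closed form of \<open>log_Phi1\<close> through \<open>Li2\<close> for \<open>Re x < 0\<close> and, by continuity, on the
      imaginary axis.

  The last two items, used at \<open>\<i>/6\<close> and \<open>- \<i>/6\<close>, give \<open>Re Li2(exp(\<pi> \<i> / 3)) = \<pi>^2 / 36\<close>, and with it the values
  of \<open>F\<close> at the poles and the two Rogers dilogarithms.  The decimals of \<open>V\<close> come from a rational
  series for \<open>V / sqrt 3\<close> whose tail is enclosed between telescoping sums.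
\<close>

section \<open>Integrals over horizontal lines and residues in a strip\<close>

lemma integrable_exp_minus_abs:
  assumes "c > 0"
  shows "integrable lborel (\<lambda>s::real. exp (- c * \<bar>s\<bar>))"
proof -
  have half: "integrable lborel (\<lambda>s::real. exp (- c * s) * indicator {0..} s)"
  proof (rule integrableI_nonneg)
    have lim: "((\<lambda>s. - exp (- c * s) / c) \<longlongrightarrow> 0) at_top"
      using assms by real_asymp
    have "(\<integral>\<^sup>+s. ennreal (exp (- c * s)) * indicator {0..} s \<partial>lborel) = ennreal (0 - (- exp (- c * 0) / c))"
      using assms lim
      by (intro nn_integral_FTC_atLeast) (auto intro!: derivative_eq_intros)
    then show "(\<integral>\<^sup>+s. ennreal (exp (- c * s) * indicator {0..} s) \<partial>lborel) < \<infinity>"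
      by (simp add: ennreal_mult' ennreal_indicator)
  qed auto
  then have "integrable lborel (\<lambda>s::real. exp (- c * (0 + (-1) * s)) * indicator {0..} (0 + (-1) * s))"
    by (rule lborel_integrable_real_affine) simp
  from Bochner_Integration.integrable_add[OF half this] show ?thesis
    by (rule Bochner_Integration.integrable_bound) (auto simp: indicator_def abs_if)
qed

lemma integrable_exp_decay:
  fixes g :: "real \<Rightarrow> 'a :: {banach, second_countable_topology}"
  assumes cont: "continuous_on UNIV g" and "c > 0"
    and decay: "\<And>s. \<bar>s\<bar> \<ge> R \<Longrightarrow> norm (g s) \<le> K * exp (- c * \<bar>s\<bar>)"
  shows "integrable lborel g"
proof (rule Bochner_Integration.integrable_bound)
  show "g \<in> borel_measurable lborel"
    using cont by (simp add: borel_measurable_continuous_onI)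
  have "integrable lborel (\<lambda>s. indicator {-R..R} s *\<^sub>R g s)"
    by (rule borel_integrable_compact) (auto intro: continuous_on_subset[OF cont])
  moreover have "integrable lborel (\<lambda>s::real. \<bar>K\<bar> * exp (- c * \<bar>s\<bar>))"
    using integrable_exp_minus_abs[OF \<open>c > 0\<close>] by (rule integrable_mult_right)
  ultimately show "integrable lborel
      (\<lambda>s. norm (indicator {-R..R} s *\<^sub>R g s) + \<bar>K\<bar> * exp (- c * \<bar>s\<bar>))"
    by (intro Bochner_Integration.integrable_add integrable_norm)
  show "AE s in lborel. norm (g s)
      \<le> norm (norm (indicator {-R..R} s *\<^sub>R g s) + \<bar>K\<bar> * exp (- c * \<bar>s\<bar>))"
  proof (rule AE_I2)
    fix s :: real
    show "norm (g s) \<le> norm (norm (indicator {-R..R} s *\<^sub>R g s) + \<bar>K\<bar> * exp (- c * \<bar>s\<bar>))"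
    proof (cases "s \<in> {-R..R}")
      case False
      then have "norm (g s) \<le> K * exp (- c * \<bar>s\<bar>)" by (intro decay) auto
      also have "\<dots> \<le> \<bar>K\<bar> * exp (- c * \<bar>s\<bar>)" by (intro mult_right_mono) auto
      finally show ?thesis using False by simp
    qed (simp add: indicator_def)
  qed
qed

lemma contour_integral_horizontal:
  assumes "R > 0"
  shows "contour_integral (linepath (Complex (-R) a) (Complex R a)) f
    = integral {-R..R} (\<lambda>s. f (of_real s + \<i> * of_real a))"
proof -
  have "linepath (Complex (-R) a) (Complex R a)
      = (+) (\<i> * of_real a) \<circ> linepath (of_real (-R)) (of_real R)"
    by (auto simp: fun_eq_iff linepath_def complex_eq_iff algebra_simps)
  then show ?thesis
    using contour_integral_linepath_Reals_eq[of "of_real (-R)" "of_real R" "\<lambda>z. f (z + \<i> * of_real a)"] assms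
    by (simp add: contour_integral_translate)
qed

lemma integral_symmetric_tendsto:
  fixes g :: "real \<Rightarrow> complex"
  assumes g: "integrable lborel g"
  shows "((\<lambda>R. integral {-R..R} g) \<longlongrightarrow> (LINT s|lborel. g s)) at_top"
proof -
  have "((\<lambda>R. LINT s|lborel. indicator {-R..R} s *\<^sub>R g s) \<longlongrightarrow> (LINT s|lborel. g s)) at_top"
  proof (rule integral_dominated_convergence_at_top[where w = "\<lambda>s. norm (g s)"])
    show "AE s in lborel. ((\<lambda>R. indicator {-R..R} s *\<^sub>R g s) \<longlongrightarrow> g s) at_top"
    proof (rule AE_I2, rule tendsto_eventually)
      fix s :: real
      show "\<forall>\<^sub>F R in at_top. indicator {-R..R} s *\<^sub>R g s = g s"
        using eventually_ge_at_top[of "\<bar>s\<bar>"]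
        by eventually_elim (auto simp: indicator_def abs_le_iff)
    qed
  qed (use g in \<open>auto intro!: always_eventually simp: indicator_def\<close>)
  moreover have "(LINT s|lborel. indicator {-R..R} s *\<^sub>R g s) = integral {-R..R} g" for R
    using set_borel_integral_eq_integral(2)[of "{-R..R}" g] g
    by (simp add: set_integrable_def set_lebesgue_integral_def integrable_mult_indicator)
  ultimately show ?thesis by simp
qed

lemma shifted_line_integrable_exp_decay:
  assumes cont: "continuous_on {z. Im z = a} f" and "c > 0"
    and decay: "\<And>z. Im z = a \<Longrightarrow> \<bar>Re z\<bar> \<ge> R \<Longrightarrow> norm (f z) \<le> K * exp (- c * \<bar>Re z\<bar>)"
  shows "shifted_line_integrable a f"
  unfolding shifted_line_integrable_def
proof (rule integrable_exp_decay[OF _ \<open>c > 0\<close>])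
  show "continuous_on UNIV (\<lambda>t. f (of_real t + \<i> * of_real a))"
    by (rule continuous_on_compose2[OF cont]) (auto intro!: continuous_intros)
  show "norm (f (of_real t + \<i> * of_real a)) \<le> K * exp (- c * \<bar>t\<bar>)" if "\<bar>t\<bar> \<ge> R" for t
    using decay[of "of_real t + \<i> * of_real a"] that by simp
qed

text \<open>
  Exponential decay makes the vertical sides of the rectangle with corners \<open>(- R, a)\<close> and \<open>(R, b)\<close>
  negligible, so the residue theorem for rectangles passes to the limit of large \<open>R\<close>.  Both contour
  shifts below, the one in the Fourier variable and the one in \<open>x\<close>, are instances.
\<close>

theorem strip_residue_theorem:
  assumes S: "open S" "connected S" "{z. a \<le> Im z \<and> Im z \<le> b} \<subseteq> S" and "a < b"
    and pts: "finite pts" "pts \<subseteq> {z. a < Im z \<and> Im z < b}"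
    and holo: "f holomorphic_on S - pts" and "c > 0"
    and decay: "\<And>z. a \<le> Im z \<Longrightarrow> Im z \<le> b \<Longrightarrow> \<bar>Re z\<bar> \<ge> r \<Longrightarrow> norm (f z) \<le> K * exp (- c * \<bar>Re z\<bar>)"
  shows "shifted_line_integral a f - shifted_line_integral b f
    = 2 * of_real pi * \<i> * (\<Sum>p\<in>pts. residue f p)"
proof -
  have cont: "continuous_on (S - pts) f"
    by (rule holomorphic_on_imp_continuous_on[OF holo])
  have line: "((\<lambda>R. integral {-R..R} (\<lambda>s. f (of_real s + \<i> * of_real y)))
      \<longlongrightarrow> shifted_line_integral y f) at_top" if "y = a \<or> y = b" for y
    unfolding shifted_line_integral_def
  proof (rule integral_symmetric_tendsto, fold shifted_line_integrable_def,
      rule shifted_line_integrable_exp_decay[OF _ \<open>c > 0\<close>])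
    show "continuous_on {z. Im z = y} f"
      by (rule continuous_on_subset[OF cont]) (use S pts that \<open>a < b\<close> in auto)
    show "norm (f z) \<le> K * exp (- c * \<bar>Re z\<bar>)" if "Im z = y" "\<bar>Re z\<bar> \<ge> r" for z
      using decay[of z] that \<open>y = a \<or> y = b\<close> \<open>a < b\<close> by auto
  qed
  obtain R1 where R1: "\<And>p. p \<in> pts \<Longrightarrow> \<bar>Re p\<bar> < R1"
  proof -
    from pts(1) have "bdd_above ((\<lambda>p. \<bar>Re p\<bar>) ` pts)" by simp
    then obtain M where "\<And>p. p \<in> pts \<Longrightarrow> \<bar>Re p\<bar> \<le> M"
      unfolding bdd_above_def by auto
    then show ?thesis by (intro that[of "M + 1"]) fastforce
  qed
  define Rmin where "Rmin = max 1 (max \<bar>r\<bar> R1)"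
  define I where "I = 2 * of_real pi * \<i> * (\<Sum>p\<in>pts. residue f p)"
  define side where "side = (\<lambda>x. contour_integral (linepath (Complex x a) (Complex x b)) f)"
  have rect: "integral {-R..R} (\<lambda>s. f (of_real s + \<i> * of_real a)) + side R
      - integral {-R..R} (\<lambda>s. f (of_real s + \<i> * of_real b)) - side (- R) = I"
    and side_bound: "norm (side R) \<le> K * exp (- c * R) * (b - a)"
      "norm (side (- R)) \<le> K * exp (- c * R) * (b - a)" if R: "R > Rmin" for R
  proof -
    from R have R': "R > 0" "R \<ge> r" and R1': "\<And>p. p \<in> pts \<Longrightarrow> \<bar>Re p\<bar> < R"
      using R1 by (force simp: Rmin_def)+
    let ?p = "rectpath (Complex (-R) a) (Complex R b)"
    have strip: "cbox (Complex (-R) a) (Complex R b) \<subseteq> S"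
      using S(3) by (auto simp: in_cbox_complex_iff)
    have avoid: "path_image ?p \<subseteq> S - pts"
    proof -
      have "path_image ?p = cbox (Complex (-R) a) (Complex R b) - box (Complex (-R) a) (Complex R b)"
        using R' \<open>a < b\<close> by (intro path_image_rectpath_cbox_minus_box) auto
      moreover have "pts \<subseteq> box (Complex (-R) a) (Complex R b)"
        using pts(2) R1' by (force simp: in_box_complex_iff abs_less_iff)
      ultimately show ?thesis using strip by blast
    qed
    have *: "f contour_integrable_on linepath u v" if "closed_segment u v \<subseteq> path_image ?p" for u v
      by (rule contour_integrable_continuous_linepath)
        (use that avoid in \<open>auto intro: continuous_on_subset[OF cont]\<close>)
    have segs: "closed_segment (Complex (-R) a) (Complex R a) \<subseteq> path_image ?p"
      "closed_segment (Complex R a) (Complex R b) \<subseteq> path_image ?p"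
      "closed_segment (Complex R b) (Complex (-R) b) \<subseteq> path_image ?p"
      "closed_segment (Complex (-R) b) (Complex (-R) a) \<subseteq> path_image ?p"
      by (auto simp: rectpath_def Let_def path_image_join)
    note ci = segs[THEN *]
    have "contour_integral ?p f = 2 * pi * \<i> * (\<Sum>p\<in>pts. winding_number ?p p * residue f p)"
    proof (rule Residue_theorem[OF S(1,2) pts(1) holo])
      show "\<forall>z. z \<notin> S \<longrightarrow> winding_number ?p z = 0"
        using strip R' \<open>a < b\<close> by (auto intro!: winding_number_rectpath_outside)
    qed (use avoid in auto)
    also have "(\<Sum>p\<in>pts. winding_number ?p p * residue f p) = (\<Sum>p\<in>pts. residue f p)"
    proof (rule sum.cong)
      fix p assume p: "p \<in> pts"
      then have "p \<in> box (Complex (-R) a) (Complex R b)"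
        using pts(2) R1'[OF p] by (auto simp: in_box_complex_iff abs_less_iff)
      then show "winding_number ?p p * residue f p = residue f p"
        by (simp add: winding_number_rectpath)
    qed simp
    finally have "contour_integral ?p f = I" by (simp add: I_def)
    moreover have "contour_integral ?p f
        = contour_integral (linepath (Complex (-R) a) (Complex R a)) f + side R
          + contour_integral (linepath (Complex R b) (Complex (-R) b)) f
          + contour_integral (linepath (Complex (-R) b) (Complex (-R) a)) f"
      using ci by (simp add: rectpath_def Let_def side_def)
    moreover have "contour_integral (linepath (Complex R b) (Complex (-R) b)) f
        = - contour_integral (linepath (Complex (-R) b) (Complex R b)) f"
      "contour_integral (linepath (Complex (-R) b) (Complex (-R) a)) f = - side (-R)"
      unfolding side_def
      using contour_integral_reversepath[of "linepath (Complex (-R) b) (Complex R b)" f]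
        contour_integral_reversepath[of "linepath (Complex (-R) a) (Complex (-R) b)" f]
      by simp_all
    ultimately show "integral {-R..R} (\<lambda>s. f (of_real s + \<i> * of_real a)) + side R
      - integral {-R..R} (\<lambda>s. f (of_real s + \<i> * of_real b)) - side (- R) = I"
      using contour_integral_horizontal[OF R'(1)] by simp
    have bound: "norm (side x) \<le> K * exp (- c * R) * (b - a)"
      if x: "f contour_integrable_on linepath (Complex x a) (Complex x b)" "\<bar>x\<bar> = R" for x
    proof -
      have 1: "norm (f z) \<le> K * exp (- c * R)" if "z \<in> closed_segment (Complex x a) (Complex x b)" for z
        using decay[of z] that x(2) \<open>a < b\<close> R'
        by (auto simp: closed_segment_same_Re closed_segment_eq_real_ivl)
      from order.trans[OF norm_ge_zero 1[of "Complex x a"]] have "K * exp (- c * R) \<ge> 0"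
        by simp
      from contour_integral_bound_linepath[OF x(1) this 1]
      have "norm (side x) \<le> K * exp (- c * R) * norm (Complex x b - Complex x a)"
        unfolding side_def by blast
      also have "norm (Complex x b - Complex x a) = b - a"
        using \<open>a < b\<close> by (simp add: cmod_def)
      finally show ?thesis .
    qed
    show "norm (side R) \<le> K * exp (- c * R) * (b - a)" using R' ci(2) by (intro bound) auto
    show "norm (side (- R)) \<le> K * exp (- c * R) * (b - a)"
      using R' *[of "Complex (-R) a" "Complex (-R) b"] segs(4)
      by (intro bound) (auto simp: closed_segment_commute)
  qed
  have bound0: "((\<lambda>R. K * exp (- c * R) * (b - a)) \<longlongrightarrow> 0) at_top"
    using \<open>c > 0\<close> by real_asymp
  have side0: "(side \<longlongrightarrow> 0) at_top" "((\<lambda>R. side (- R)) \<longlongrightarrow> 0) at_top"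
    by (rule Lim_null_comparison[OF _ bound0], use side_bound in \<open>auto intro: eventually_mono[OF eventually_gt_at_top[of Rmin]]\<close>)+
  have "((\<lambda>R. integral {-R..R} (\<lambda>s. f (of_real s + \<i> * of_real a)) + side R
      - integral {-R..R} (\<lambda>s. f (of_real s + \<i> * of_real b)) - side (- R))
      \<longlongrightarrow> shifted_line_integral a f + 0 - shifted_line_integral b f - 0) at_top"
    by (intro tendsto_intros line side0) auto
  moreover have "((\<lambda>R. integral {-R..R} (\<lambda>s. f (of_real s + \<i> * of_real a)) + side R
      - integral {-R..R} (\<lambda>s. f (of_real s + \<i> * of_real b)) - side (- R)) \<longlongrightarrow> I) at_top"
    by (rule tendsto_eventually) (use rect in \<open>auto intro: eventually_mono[OF eventually_gt_at_top[of Rmin]]\<close>)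
  ultimately show ?thesis
    using tendsto_unique[OF trivial_limit_at_top_linorder] by (force simp: I_def)
qed

section \<open>The exponent of the quantum dilogarithm and its derivative\<close>

text \<open>
  Complex differentiation under the integral sign: the difference quotients are dominated by an
  integrable function, so dominated convergence applies along every sequence tending to \<open>x\<close>.
\<close>

lemma has_field_derivative_LINT_dominated:
  fixes f :: "complex \<Rightarrow> real \<Rightarrow> complex"
  assumes "d > 0"
    and int: "\<And>y. dist y x < d \<Longrightarrow> integrable lborel (f y)"
    and deriv: "\<And>t. ((\<lambda>y. f y t) has_field_derivative f' t) (at x)"
    and meas: "f' \<in> borel_measurable borel"
    and w: "integrable lborel w"
    and bound: "\<And>y t. dist y x < d \<Longrightarrow> y \<noteq> x \<Longrightarrow> norm ((f y t - f x t) / (y - x)) \<le> w t"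
  shows "((\<lambda>y. LINT t|lborel. f y t) has_field_derivative (LINT t|lborel. f' t)) (at x)"
  unfolding has_field_derivative_iff tendsto_at_iff_sequentially
proof (intro allI impI)
  fix X :: "nat \<Rightarrow> complex"
  assume X: "\<forall>i. X i \<in> UNIV - {x}" "X \<longlonglongrightarrow> x"
  from X(2) \<open>d > 0\<close> obtain N where N: "\<And>n. n \<ge> N \<Longrightarrow> dist (X n) x < d"
    unfolding lim_sequentially by blast
  have intx: "integrable lborel (f x)" using int[of x] \<open>d > 0\<close> by simp
  have "(\<lambda>n. LINT t|lborel. (f (X (n + N)) t - f x t) / (X (n + N) - x)) \<longlonglongrightarrow> (LINT t|lborel. f' t)"
  proof (rule integral_dominated_convergence[OF _ _ w])
    show "f' \<in> borel_measurable lborel" using meas by simp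
    show "(\<lambda>t. (f (X (n + N)) t - f x t) / (X (n + N) - x)) \<in> borel_measurable lborel" for n
      using int[OF N, of "n + N"] intx by auto
    show "AE t in lborel. (\<lambda>n. (f (X (n + N)) t - f x t) / (X (n + N) - x)) \<longlonglongrightarrow> f' t"
    proof (rule AE_I2)
      fix t
      have "(\<lambda>n. (f (X n) t - f x t) / (X n - x)) \<longlonglongrightarrow> f' t"
        using deriv[of t] X unfolding has_field_derivative_iff tendsto_at_iff_sequentially
        by (auto simp: o_def)
      then show "(\<lambda>n. (f (X (n + N)) t - f x t) / (X (n + N) - x)) \<longlonglongrightarrow> f' t"
        by (rule LIMSEQ_ignore_initial_segment)
    qed
    show "AE t in lborel. norm ((f (X (n + N)) t - f x t) / (X (n + N) - x)) \<le> w t" for n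
      by (intro AE_I2 bound N) (use X in auto)
  qed
  moreover have "(LINT t|lborel. (f (X (n + N)) t - f x t) / (X (n + N) - x))
      = ((LINT t|lborel. f (X (n + N)) t) - (LINT t|lborel. f x t)) / (X (n + N) - x)" for n
    using int[OF N, of "n + N"] intx by (simp add: Bochner_Integration.integral_diff)
  ultimately have "(\<lambda>n. ((LINT t|lborel. f (X (n + N)) t) - (LINT t|lborel. f x t)) / (X (n + N) - x))
      \<longlonglongrightarrow> (LINT t|lborel. f' t)" by (simp only:)
  then show "((\<lambda>y. ((LINT t|lborel. f y t) - (LINT t|lborel. f x t)) / (y - x)) \<circ> X)
      \<longlonglongrightarrow> (LINT t|lborel. f' t)"
    unfolding o_def by (rule LIMSEQ_offset)
qed

lemma mult_le_bound_abs: "\<bar>a\<bar> \<le> c \<Longrightarrow> a * b \<le> c * \<bar>b\<bar>" for a b c :: real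
  by (rule order.trans[OF abs_ge_self]) (simp add: abs_mult mult_right_mono)

lemma norm_exp_minus_1_le: "norm (exp z - 1) \<le> norm z * exp (norm z)" for z :: complex
proof -
  have "norm (exp z - 1) \<le> exp \<bar>Re z\<bar> * norm z"
    using Taylor_exp[of z 0] by simp
  also have "\<dots> \<le> exp (norm z) * norm z"
    by (intro mult_right_mono) (auto simp: abs_Re_le_cmod)
  finally show ?thesis by (simp add: mult.commute)
qed

lemma norm_sinh_ge:
  fixes t :: complex
  assumes "\<bar>Re t\<bar> \<ge> 1"
  shows "exp \<bar>Re t\<bar> / 4 \<le> norm (sinh t)"
proof -
  have "exp \<bar>Re t\<bar> - exp (- \<bar>Re t\<bar>) \<le> norm (exp t - exp (- t))"
    using norm_triangle_ineq2[of "exp t" "exp (- t)"] norm_triangle_ineq2[of "exp (- t)" "exp t"]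
    by (cases "Re t \<ge> 0") (auto simp: norm_minus_commute)
  moreover have "exp (- \<bar>Re t\<bar>) \<le> exp \<bar>Re t\<bar> / 2"
  proof -
    have "2 \<le> exp (1::real)" using exp_ge_add_one_self[of 1] by simp
    also have "\<dots> \<le> exp (2 * \<bar>Re t\<bar>)" using assms by simp
    finally show ?thesis by (simp add: exp_minus field_simps flip: exp_add)
  qed
  ultimately have "exp \<bar>Re t\<bar> / 4 \<le> norm (exp t - exp (- t)) / 2" by simp
  also have "\<dots> = norm (sinh t)" by (simp add: sinh_field_def norm_divide)
  finally show ?thesis .
qed

lemma exp_eq_1_strip:
  assumes "\<bar>Im z\<bar> < 2 * pi" shows "exp z = 1 \<longleftrightarrow> z = 0"
proof
  assume "exp z = 1"
  then obtain n :: int where n: "Re z = 0" "Im z = of_int n * 2 * pi"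
    by (auto simp: exp_eq_1)
  with assms have "\<bar>of_int n * 2 * pi\<bar> < 2 * pi" by simp
  then have "\<bar>real_of_int n\<bar> < 1" by (simp add: abs_mult)
  then have "n = 0" by linarith
  with n show "z = 0" by (simp add: complex_eq_iff)
qed simp

lemma sinh_eq_0_strip:
  assumes "\<bar>Im t\<bar> < pi" shows "sinh t = 0 \<longleftrightarrow> t = (0::complex)"
proof -
  have "sinh t = (exp (2 * t) - 1) / (2 * exp t)"
    by (simp add: sinh_field_def field_simps exp_minus flip: exp_add) 
  then show ?thesis
    using exp_eq_1_strip[of "2 * t"] assms by simp
qed

text \<open>
  The factor \<open>1 / t\<close> of the integrand of \<open>Phi1\<close> is split off because differentiating in \<open>x\<close> cancels
  it: \<open>fourier_kernel\<close> alone is, up to the factor \<open>- 2 \<i>\<close>, the integrand of the logarithmic derivative.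
\<close>

definition fourier_kernel :: "complex \<Rightarrow> complex \<Rightarrow> complex"
  where "fourier_kernel x t = exp (- 2 * \<i> * x * t) / (4 * sinh t ^ 2)"

definition log_Phi :: "real \<Rightarrow> complex \<Rightarrow> complex"
  where "log_Phi \<epsilon> x = shifted_line_integral \<epsilon> (\<lambda>t. fourier_kernel x t * (1 / t))"

text \<open>
  Since \<open>sinh t ^ 2\<close> grows like \<open>exp (2 * \<bar>Re t\<bar>) / 4\<close>, the kernel decays in both directions exactly
  when \<open>\<bar>Im x\<bar> < 1\<close>.  The rate does not depend on \<open>Im t\<close>, so the contour can be moved.
\<close>

lemma norm_fourier_kernel_le:
  assumes "\<bar>Re t\<bar> \<ge> 1"
  shows "norm (fourier_kernel x t) \<le> 4 * exp (2 * Re x * Im t) * exp (- 2 * (1 - \<bar>Im x\<bar>) * \<bar>Re t\<bar>)"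
proof -
  have "(exp \<bar>Re t\<bar> / 4) ^ 2 \<le> norm (sinh t) ^ 2"
    by (intro power_mono norm_sinh_ge assms) auto
  then have sinh2: "exp (2 * \<bar>Re t\<bar>) / 4 \<le> 4 * norm (sinh t) ^ 2"
    by (simp add: power_divide flip: exp_double)
  have "norm (fourier_kernel x t) = exp (2 * (Re x * Im t + Im x * Re t)) / (4 * norm (sinh t) ^ 2)"
    by (simp add: fourier_kernel_def norm_divide norm_mult norm_power algebra_simps)
  also have "\<dots> \<le> exp (2 * (Re x * Im t + Im x * Re t)) / (exp (2 * \<bar>Re t\<bar>) / 4)"
    by (intro divide_left_mono sinh2 mult_pos_pos) (use sinh2 in \<open>auto intro!: order.strict_trans2[OF _ sinh2]\<close>)
  also have "\<dots> = 4 * exp (2 * Re x * Im t) * exp (2 * (Im x * Re t) - 2 * \<bar>Re t\<bar>)"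
    by (simp add: exp_diff exp_add algebra_simps)
  also have "\<dots> \<le> 4 * exp (2 * Re x * Im t) * exp (- 2 * (1 - \<bar>Im x\<bar>) * \<bar>Re t\<bar>)"
  proof -
    have "Im x * Re t \<le> \<bar>Im x\<bar> * \<bar>Re t\<bar>" by (metis abs_ge_self abs_mult)
    then show ?thesis by (simp add: algebra_simps)
  qed
  finally show ?thesis .
qed

lemma holomorphic_on_sinh [holomorphic_intros]: "sinh holomorphic_on S" for S :: "complex set"
  unfolding sinh_field_def[abs_def] by (intro holomorphic_intros) auto

lemma holomorphic_on_cosh [holomorphic_intros]: "cosh holomorphic_on S" for S :: "complex set"
  unfolding cosh_field_def[abs_def] by (intro holomorphic_intros) auto

lemma fourier_kernel_holomorphic: "fourier_kernel x holomorphic_on {t. \<bar>Im t\<bar> < pi} - {0}"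
  unfolding fourier_kernel_def by (auto intro!: holomorphic_intros simp: sinh_eq_0_strip)

lemma continuous_on_fourier_kernel:
  assumes "0 < \<epsilon>" "\<epsilon> < pi"
  shows "continuous_on UNIV (\<lambda>s. fourier_kernel x (of_real s + \<i> * of_real \<epsilon>))"
  by (rule continuous_on_compose2[OF holomorphic_on_imp_continuous_on[OF fourier_kernel_holomorphic]])
    (use assms in \<open>auto intro!: continuous_intros simp: complex_eq_iff\<close>)

lemma shifted_line_neq_0: "\<epsilon> > 0 \<Longrightarrow> complex_of_real s + \<i> * of_real \<epsilon> \<noteq> 0"
  by (simp add: complex_eq_iff)

lemma shifted_line_norm_inverse_le:
  assumes "\<epsilon> > 0" shows "norm (1 / (complex_of_real s + \<i> * of_real \<epsilon>)) \<le> 1 / \<epsilon>"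
proof -
  have "\<epsilon> \<le> norm (complex_of_real s + \<i> * of_real \<epsilon>)"
    using abs_Im_le_cmod[of "complex_of_real s + \<i> * of_real \<epsilon>"] by simp
  then show ?thesis
    using assms by (simp add: norm_divide frac_le)
qed

lemma integrable_log_Phi:
  assumes "0 < \<epsilon>" "\<epsilon> < pi" "\<bar>Im x\<bar> < 1"
  shows "integrable lborel (\<lambda>s. fourier_kernel x (of_real s + \<i> * of_real \<epsilon>) * (1 / (of_real s + \<i> * of_real \<epsilon>)))"
proof (rule integrable_exp_decay[where c = "2 * (1 - \<bar>Im x\<bar>)" and R = 1 and K = "4 * exp (2 * Re x * \<epsilon>) / \<epsilon>"])
  show "continuous_on UNIV (\<lambda>s. fourier_kernel x (of_real s + \<i> * of_real \<epsilon>) * (1 / (of_real s + \<i> * of_real \<epsilon>)))"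
    using assms by (intro continuous_intros continuous_on_fourier_kernel) (auto simp: complex_eq_iff)
  fix s :: real assume s: "\<bar>s\<bar> \<ge> 1"
  have "norm (fourier_kernel x (of_real s + \<i> * of_real \<epsilon>) * (1 / (of_real s + \<i> * of_real \<epsilon>)))
    \<le> (4 * exp (2 * Re x * \<epsilon>) * exp (- 2 * (1 - \<bar>Im x\<bar>) * \<bar>s\<bar>)) * (1 / \<epsilon>)"
    unfolding norm_mult
    using norm_fourier_kernel_le[of "of_real s + \<i> * of_real \<epsilon>" x] s shifted_line_norm_inverse_le[OF assms(1), of s]
    by (intro mult_mono) auto
  then show "norm (fourier_kernel x (of_real s + \<i> * of_real \<epsilon>) * (1 / (of_real s + \<i> * of_real \<epsilon>)))
    \<le> 4 * exp (2 * Re x * \<epsilon>) / \<epsilon> * exp (- (2 * (1 - \<bar>Im x\<bar>)) * \<bar>s\<bar>)"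
    by (simp add: field_simps)
qed (use assms in auto)

text \<open>
  The dependence on \<open>Re x\<close> enters the integrand only through the factor \<open>exp (2 * \<epsilon> * Re x)\<close> in
  absolute value.  This gives both boundedness for \<open>Re x \<le> 0\<close> and decay towards the left.
\<close>

lemma log_Phi_bound:
  assumes "0 < \<epsilon>" "\<epsilon> < pi" "0 \<le> \<delta>" "\<delta> < 1"
  obtains W where "\<And>x. \<bar>Im x\<bar> \<le> \<delta> \<Longrightarrow> norm (log_Phi \<epsilon> x) \<le> W * exp (2 * \<epsilon> * Re x)"
proof -
  let ?t = "\<lambda>s. complex_of_real s + \<i> * of_real \<epsilon>"
  define w where "w = (\<lambda>s. norm (fourier_kernel 0 (?t s) * (1 / ?t s)) * exp (2 * \<delta> * \<bar>s\<bar>))"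
  have w: "integrable lborel w"
  proof (rule integrable_exp_decay[where c = "2 * (1 - \<delta>)" and R = 1 and K = "4 / \<epsilon>"])
    show "continuous_on UNIV w" unfolding w_def
      using assms by (intro continuous_intros continuous_on_fourier_kernel) (auto simp: complex_eq_iff)
    fix s :: real assume s: "\<bar>s\<bar> \<ge> 1"
    have "w s \<le> 4 * exp (- 2 * \<bar>s\<bar>) * (1 / \<epsilon>) * exp (2 * \<delta> * \<bar>s\<bar>)"
      unfolding w_def norm_mult
      using norm_fourier_kernel_le[of "?t s" 0] s shifted_line_norm_inverse_le[OF assms(1), of s] assms(1)
      by (intro mult_mono) auto
    also have "\<dots> = 4 / \<epsilon> * exp (- (2 * (1 - \<delta>)) * \<bar>s\<bar>)"
      by (simp add: algebra_simps flip: exp_add)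
    finally show "norm (w s) \<le> 4 / \<epsilon> * exp (- (2 * (1 - \<delta>)) * \<bar>s\<bar>)"
      by (simp add: w_def)
  qed (use assms in auto)
  show ?thesis
  proof (rule that[of "LINT s|lborel. w s"])
    fix x assume x: "\<bar>Im x\<bar> \<le> \<delta>"
    have "norm (log_Phi \<epsilon> x) \<le> (LINT s|lborel. exp (2 * \<epsilon> * Re x) * w s)"
      unfolding log_Phi_def shifted_line_integral_def
    proof (rule order.trans[OF integral_norm_bound], rule integral_mono)
      show "integrable lborel (\<lambda>s. norm (fourier_kernel x (?t s) * (1 / ?t s)))"
        using integrable_log_Phi[of \<epsilon> x] assms x by (intro integrable_norm) auto
      show "integrable lborel (\<lambda>s. exp (2 * \<epsilon> * Re x) * w s)"
        using w by simp
      fix s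
      have "Im x * s \<le> \<delta> * \<bar>s\<bar>"
        using mult_le_bound_abs[OF x] .
      then have "exp (2 * (Re x * \<epsilon> + Im x * s)) \<le> exp (2 * \<epsilon> * Re x) * exp (2 * \<delta> * \<bar>s\<bar>)"
        by (simp add: algebra_simps flip: exp_add)
      then have "exp (2 * (Re x * \<epsilon> + Im x * s)) * norm (fourier_kernel 0 (?t s) * (1 / ?t s))
        \<le> exp (2 * \<epsilon> * Re x) * exp (2 * \<delta> * \<bar>s\<bar>) * norm (fourier_kernel 0 (?t s) * (1 / ?t s))"
        by (rule mult_right_mono) simp
      then show "norm (fourier_kernel x (?t s) * (1 / ?t s)) \<le> exp (2 * \<epsilon> * Re x) * w s"
        by (simp add: w_def fourier_kernel_def norm_mult norm_divide algebra_simps)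
    qed
    then show "norm (log_Phi \<epsilon> x) \<le> (LINT s|lborel. w s) * exp (2 * \<epsilon> * Re x)"
      by (simp add: mult.commute)
  qed
qed

lemma log_Phi_has_field_derivative_integral:
  assumes "0 < \<epsilon>" "\<epsilon> < pi" "\<bar>Im x\<bar> < 1"
  shows "(log_Phi \<epsilon> has_field_derivative - 2 * \<i> * shifted_line_integral \<epsilon> (fourier_kernel x)) (at x)"
proof -
  let ?t = "\<lambda>s. complex_of_real s + \<i> * of_real \<epsilon>"
  define d where "d = (1 - \<bar>Im x\<bar>) / 2"
  define w where "w = (\<lambda>s. 2 * norm (fourier_kernel x (?t s)) * exp (2 * d * (\<bar>s\<bar> + \<epsilon>)))"
  have d: "d > 0" using assms by (simp add: d_def)
  have near: "\<bar>Im y\<bar> < 1" if "dist y x < d" for y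
  proof -
    have "\<bar>Im y - Im x\<bar> < d"
      using abs_Im_le_cmod[of "y - x"] that by (simp add: dist_norm)
    then have "\<bar>Im y\<bar> < \<bar>Im x\<bar> + d" by linarith
    then show ?thesis unfolding d_def using assms(3) by (simp add: field_simps)
  qed
  have "((\<lambda>y. LINT s|lborel. fourier_kernel y (?t s) * (1 / ?t s)) has_field_derivative
      (LINT s|lborel. - 2 * \<i> * fourier_kernel x (?t s))) (at x)"
  proof (rule has_field_derivative_LINT_dominated[OF d, where w = w])
    show "integrable lborel (\<lambda>s. fourier_kernel y (?t s) * (1 / ?t s))" if "dist y x < d" for y
      using integrable_log_Phi assms near[OF that] by blast
    show "((\<lambda>y. fourier_kernel y (?t s) * (1 / ?t s)) has_field_derivative - 2 * \<i> * fourier_kernel x (?t s)) (at x)" for s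
    proof -
      define c where "c = 1 / (4 * sinh (?t s) ^ 2) * (1 / ?t s)"
      have t0: "?t s \<noteq> 0" using assms(1) by (rule shifted_line_neq_0)
      have "((\<lambda>y. exp (- 2 * \<i> * y * ?t s) * c) has_field_derivative exp (- 2 * \<i> * x * ?t s) * (- 2 * \<i> * ?t s) * c) (at x)"
        by (auto intro!: derivative_eq_intros)
      moreover have "(\<lambda>y. fourier_kernel y (?t s) * (1 / ?t s)) = (\<lambda>y. exp (- 2 * \<i> * y * ?t s) * c)"
        by (simp add: fun_eq_iff fourier_kernel_def c_def)
      moreover have "- 2 * \<i> * fourier_kernel x (?t s) = exp (- 2 * \<i> * x * ?t s) * (- 2 * \<i> * ?t s) * c"
      proof -
        have "- 2 * \<i> * (E / (4 * q)) = E * (- 2 * \<i> * t) * (1 / (4 * q) * (1 / t))"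
          if "t \<noteq> 0" for E q t :: complex using that by (simp add: divide_simps)
        then show ?thesis unfolding fourier_kernel_def c_def using t0 by blast
      qed
      ultimately show ?thesis by (simp only:)
    qed
    show "(\<lambda>s. - 2 * \<i> * fourier_kernel x (?t s)) \<in> borel_measurable borel"
    proof -
      have "continuous_on UNIV (\<lambda>s. - 2 * \<i> * fourier_kernel x (?t s))"
        using assms by (intro continuous_on_mult continuous_on_const continuous_on_fourier_kernel)
      then show ?thesis by (rule borel_measurable_continuous_onI)
    qed
    show "integrable lborel w"
    proof (rule integrable_exp_decay[where c = "2 * d" and R = 1 and K = "8 * exp (2 * Re x * \<epsilon>) * exp (2 * d * \<epsilon>)"])
      show "continuous_on UNIV w" unfolding w_def
        using assms by (intro continuous_intros continuous_on_fourier_kernel)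
      fix s :: real assume "\<bar>s\<bar> \<ge> 1"
      then have "w s \<le> 2 * (4 * exp (2 * Re x * \<epsilon>) * exp (- 2 * (1 - \<bar>Im x\<bar>) * \<bar>s\<bar>)) * exp (2 * d * (\<bar>s\<bar> + \<epsilon>))"
        unfolding w_def using norm_fourier_kernel_le[of "?t s" x]
        by (intro mult_right_mono mult_left_mono) auto
      also have "\<dots> = 8 * exp (2 * Re x * \<epsilon>) * (exp (- 2 * (1 - \<bar>Im x\<bar>) * \<bar>s\<bar>) * exp (2 * d * (\<bar>s\<bar> + \<epsilon>)))"
        by simp
      also have "exp (- 2 * (1 - \<bar>Im x\<bar>) * \<bar>s\<bar>) * exp (2 * d * (\<bar>s\<bar> + \<epsilon>)) = exp (2 * d * \<epsilon>) * exp (- (2 * d) * \<bar>s\<bar>)"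
        unfolding exp_add[symmetric] by (rule arg_cong[of _ _ exp]) (simp add: d_def field_simps)
      also have "8 * exp (2 * Re x * \<epsilon>) * \<dots> = 8 * exp (2 * Re x * \<epsilon>) * exp (2 * d * \<epsilon>) * exp (- (2 * d) * \<bar>s\<bar>)"
        by simp
      finally show "norm (w s) \<le> 8 * exp (2 * Re x * \<epsilon>) * exp (2 * d * \<epsilon>) * exp (- (2 * d) * \<bar>s\<bar>)"
        by (simp add: w_def)
    qed (use d in auto)
    fix y s assume y: "dist y x < d" "y \<noteq> x"
    define u where "u = - 2 * \<i> * (y - x) * ?t s"
    have t0: "?t s \<noteq> 0" using assms(1) by (rule shifted_line_neq_0)
    have nt: "norm (?t s) \<le> \<bar>s\<bar> + \<epsilon>"
      using assms(1) norm_triangle_ineq[of "of_real s" "\<i> * of_real \<epsilon>"] by (simp add: norm_mult)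
    have "exp (- 2 * \<i> * y * ?t s) = exp (- 2 * \<i> * x * ?t s) * exp u"
      unfolding exp_add[symmetric] u_def by (rule arg_cong[of _ _ exp]) (simp add: algebra_simps)
    then have "fourier_kernel y (?t s) = fourier_kernel x (?t s) * exp u"
      by (simp add: fourier_kernel_def)
    then have "(fourier_kernel y (?t s) * (1 / ?t s) - fourier_kernel x (?t s) * (1 / ?t s)) / (y - x)
        = fourier_kernel x (?t s) * (exp u - 1) / (?t s * (y - x))"
      by (simp add: right_diff_distrib diff_divide_distrib)
    then have "norm ((fourier_kernel y (?t s) * (1 / ?t s) - fourier_kernel x (?t s) * (1 / ?t s)) / (y - x))
        = norm (fourier_kernel x (?t s)) * norm (exp u - 1) / (norm (?t s) * norm (y - x))"
      by (simp only: norm_mult norm_divide)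
    also have "\<dots> \<le> norm (fourier_kernel x (?t s)) * (norm u * exp (norm u)) / (norm (?t s) * norm (y - x))"
      by (intro divide_right_mono mult_left_mono norm_exp_minus_1_le) auto
    also have "\<dots> = 2 * norm (fourier_kernel x (?t s)) * exp (norm u)"
    proof -
      have "norm u = 2 * (norm (?t s) * norm (y - x))" by (simp add: u_def norm_mult)
      moreover have "norm (?t s) * norm (y - x) \<noteq> 0" using y(2) t0 by simp
      ultimately show ?thesis by simp
    qed
    also have "\<dots> \<le> w s"
    proof -
      have "norm u = 2 * norm (y - x) * norm (?t s)" by (simp add: u_def norm_mult)
      also have "\<dots> \<le> 2 * d * (\<bar>s\<bar> + \<epsilon>)"
        using y(1) d nt by (intro mult_mono) (simp_all add: dist_norm)
      finally show ?thesis unfolding w_def by (intro mult_left_mono) auto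
    qed
    finally show "norm ((fourier_kernel y (?t s) * (1 / ?t s) - fourier_kernel x (?t s) * (1 / ?t s)) / (y - x)) \<le> w s" .
  qed
  then show ?thesis
    by (simp add: log_Phi_def[abs_def] shifted_line_integral_def)
qed

text \<open>
  The pole is double, but integration by parts trades \<open>1 / sinh t ^ 2\<close> for \<open>- coth t\<close>, whose pole is
  simple.
\<close>

lemma residue_fourier_kernel: "residue (fourier_kernel x) 0 = - \<i> * x / 2"
proof -
  define g where "g = (\<lambda>t. (exp (- 2 * \<i> * x * t) * cosh t) / sinh t)"
  define p where "p = (\<lambda>t. 1 / sinh t ^ 2 * exp (- 2 * \<i> * x * t) + 2 * \<i> * x * g t)"
  have nz: "sinh t \<noteq> 0" if "t \<in> ball 0 1 - {0}" for t :: complex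
  proof -
    have "\<bar>Im t\<bar> < 1" using that abs_Im_le_cmod[of t] by auto
    then have "\<bar>Im t\<bar> < pi" using pi_gt3 by linarith
    then show ?thesis using that by (simp add: sinh_eq_0_strip)
  qed
  have g: "g holomorphic_on ball 0 1 - {0}"
    unfolding g_def by (auto intro!: holomorphic_intros simp: nz)
  have k: "fourier_kernel x holomorphic_on ball 0 1 - {0}"
    unfolding fourier_kernel_def by (auto intro!: holomorphic_intros simp: nz)
  have "residue g 0 = (exp (- 2 * \<i> * x * 0) * cosh 0) / 1"
    unfolding g_def
    by (rule residue_simple_pole_deriv[where s = UNIV])
      (auto intro!: holomorphic_intros derivative_eq_intros)
  then have res_g: "residue g 0 = 1" by simp
  have int_g: "(g has_contour_integral 2 * pi * \<i> * 1) (circlepath 0 (1/2))"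
    using base_residue[of "ball 0 1" 0 "1/2" g] g res_g by (auto simp: subset_iff)
  have int_k: "(fourier_kernel x has_contour_integral 2 * pi * \<i> * residue (fourier_kernel x) 0) (circlepath 0 (1/2))"
    using base_residue[of "ball 0 1" 0 "1/2" "fourier_kernel x"] k by (auto simp: subset_iff)
  \<comment> \<open>\<open>p\<close> is the derivative of \<open>- coth t * exp (- 2 \<i> x t)\<close>, so it has no residue\<close>
  have int_p: "(p has_contour_integral 0) (circlepath 0 (1/2))"
  proof (rule Cauchy_theorem_primitive[where S = "ball 0 1 - {0}" and f = "\<lambda>t. - g t"])
    fix t :: complex assume t: "t \<in> ball 0 1 - {0}"
    have cosh2: "cosh t * cosh t = 1 + sinh t * sinh t"
      using cosh_square_eq[of t] by (simp add: power2_eq_square)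
    have "p t = - (((exp (- 2 * \<i> * x * t) * (- 2 * \<i> * x) * cosh t + exp (- 2 * \<i> * x * t) * sinh t) * sinh t
        - exp (- 2 * \<i> * x * t) * (cosh t * cosh t)) / (sinh t * sinh t))"
      unfolding cosh2 unfolding g_def p_def using nz[OF t] by (simp add: field_simps power2_eq_square)
    then show "((\<lambda>t. - g t) has_field_derivative p t) (at t within ball 0 1 - {0})"
      unfolding g_def using nz[OF t]
      by (auto intro!: derivative_eq_intros simp: algebra_simps)
  qed auto
  have "((\<lambda>t. 1 / 4 * p t - \<i> * x / 2 * g t) has_contour_integral (1 / 4 * 0 - \<i> * x / 2 * (2 * pi * \<i> * 1))) (circlepath 0 (1/2))"
    by (intro has_contour_integral_diff has_contour_integral_lmul int_p int_g)
  moreover have "(\<lambda>t. 1 / 4 * p t - \<i> * x / 2 * g t) = fourier_kernel x"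
    by (auto simp: fun_eq_iff p_def fourier_kernel_def algebra_simps)
  ultimately have "2 * pi * \<i> * residue (fourier_kernel x) 0 = - (\<i> * x / 2 * (2 * pi * \<i> * 1))"
    using contour_integral_unique[OF int_k] contour_integral_unique by fastforce
  then have "(2 * pi * \<i>) * residue (fourier_kernel x) 0 = (2 * pi * \<i>) * (- \<i> * x / 2)"
    by (simp add: algebra_simps)
  then show ?thesis by (subst (asm) mult_cancel_left) simp
qed

text \<open>
  As \<open>sinh t ^ 2\<close> has period \<open>\<pi> \<i>\<close>, lowering the contour by \<open>\<pi> \<i>\<close> multiplies the integral by
  \<open>exp (- 2 \<pi> x)\<close>; the two integrals differ by \<open>2 \<pi> \<i>\<close> times the residue at \<open>0\<close>.
\<close>

lemma integral_fourier_kernel: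
  fixes x :: complex
  assumes "0 < \<epsilon>" "\<epsilon> < pi" "\<bar>Im x\<bar> < 1"
  shows "(exp (- 2 * pi * x) - 1) * shifted_line_integral \<epsilon> (fourier_kernel x) = pi * x"
proof -
  have shift: "fourier_kernel x (of_real s + \<i> * of_real (\<epsilon> - pi))
      = exp (- 2 * pi * x) * fourier_kernel x (of_real s + \<i> * of_real \<epsilon>)" for s
  proof -
    define t where "t = of_real s + \<i> * of_real (\<epsilon> - pi)"
    have t: "of_real s + \<i> * of_real \<epsilon> = t + \<i> * pi" by (simp add: t_def algebra_simps)
    have "exp (t + \<i> * pi) = - exp t" "exp (- (t + \<i> * pi)) = - exp (- t)"
      by (simp_all add: exp_add exp_diff)
    then have "sinh (t + \<i> * pi) = - sinh t"
      unfolding sinh_field_def by (simp only:) (simp add: field_simps)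
    moreover have "exp (- 2 * \<i> * x * t) = exp (- 2 * pi * x) * exp (- 2 * \<i> * x * (t + \<i> * pi))"
      by (simp add: algebra_simps flip: exp_add)
    ultimately show ?thesis
      unfolding t fourier_kernel_def t_def[symmetric] by simp
  qed
  have "shifted_line_integral (\<epsilon> - pi) (fourier_kernel x) - shifted_line_integral \<epsilon> (fourier_kernel x)
      = 2 * of_real pi * \<i> * (\<Sum>p\<in>{0}. residue (fourier_kernel x) p)"
  proof (rule strip_residue_theorem[where S = "{t. \<bar>Im t\<bar> < pi}" and c = "2 * (1 - \<bar>Im x\<bar>)" and r = 1
        and K = "4 * exp (2 * \<bar>Re x\<bar> * pi)"])
    have "{t. \<bar>Im t\<bar> < pi} = {t. Im t < pi} \<inter> {t. Im t > - pi}" by auto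
    then show "open {t. \<bar>Im t\<bar> < pi}" "connected {t. \<bar>Im t\<bar> < pi}"
      by (auto intro!: convex_connected convex_Int convex_halfspace_Im_lt convex_halfspace_Im_gt
          open_Int open_halfspace_Im_lt open_halfspace_Im_gt)
    fix t assume t: "\<epsilon> - pi \<le> Im t" "Im t \<le> \<epsilon>" "1 \<le> \<bar>Re t\<bar>"
    have "\<bar>Im t\<bar> \<le> pi" using t assms by auto
    then have "Re x * Im t \<le> \<bar>Re x\<bar> * pi"
      using mult_le_bound_abs[of "Im t" pi "Re x"] by (simp add: mult.commute)
    then have "4 * exp (2 * Re x * Im t) * exp (- 2 * (1 - \<bar>Im x\<bar>) * \<bar>Re t\<bar>)
        \<le> 4 * exp (2 * \<bar>Re x\<bar> * pi) * exp (- 2 * (1 - \<bar>Im x\<bar>) * \<bar>Re t\<bar>)"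
      by (intro mult_right_mono) auto
    with norm_fourier_kernel_le[OF t(3)]
    show "norm (fourier_kernel x t) \<le> 4 * exp (2 * \<bar>Re x\<bar> * pi) * exp (- (2 * (1 - \<bar>Im x\<bar>)) * \<bar>Re t\<bar>)"
      by (smt (verit))
  qed (use assms fourier_kernel_holomorphic in auto)
  moreover have "shifted_line_integral (\<epsilon> - pi) (fourier_kernel x)
      = exp (- 2 * pi * x) * shifted_line_integral \<epsilon> (fourier_kernel x)"
    unfolding shifted_line_integral_def shift by simp
  ultimately show ?thesis
    by (simp add: residue_fourier_kernel algebra_simps)
qed

theorem log_Phi_has_field_derivative:
  fixes x :: complex
  assumes "0 < \<epsilon>" "\<epsilon> < pi" "\<bar>Im x\<bar> < 1" "x \<noteq> 0"
  shows "(log_Phi \<epsilon> has_field_derivative - 2 * pi * \<i> * x / (exp (- 2 * pi * x) - 1)) (at x)"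
proof -
  have "exp (- 2 * pi * x) \<noteq> 1"
    using exp_eq_1_strip[of "- 2 * pi * x"] assms by (auto simp: abs_mult)
  then have "shifted_line_integral \<epsilon> (fourier_kernel x) = pi * x / (exp (- 2 * pi * x) - 1)"
    using integral_fourier_kernel[OF assms(1-3)] by (simp add: field_simps)
  with log_Phi_has_field_derivative_integral[OF assms(1-3)] show ?thesis
    by (simp add: mult_ac)
qed

section \<open>Functional equation, inversion and dilogarithm formula\<close>

abbreviation phi_strip :: "complex set"
  where "phi_strip \<equiv> {x. \<bar>Im x\<bar> < 1}"

lemma Im_strip_eq: "{x. a < Im x \<and> Im x < b} = {x. Im x > a} \<inter> {x. Im x < b}"
  by auto

lemma open_Im_strip: "open {x. a < Im x \<and> Im x < b}"
  unfolding Im_strip_eq by (intro open_Int open_halfspace_Im_lt open_halfspace_Im_gt)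

lemma connected_Im_strip: "connected {x. a < Im x \<and> Im x < b}"
  unfolding Im_strip_eq
  by (intro convex_connected convex_Int convex_halfspace_Im_lt convex_halfspace_Im_gt)

lemma phi_strip_eq: "phi_strip = {x. -1 < Im x \<and> Im x < 1}"
  by auto

lemma open_phi_strip: "open phi_strip" and connected_phi_strip: "connected phi_strip"
  unfolding phi_strip_eq by (rule open_Im_strip connected_Im_strip)+

text \<open>
  The common source of the identities for \<open>log_Phi1\<close>.  A limit takes the place of an initial value,
  because the natural base point is minus infinity; the exceptional set accommodates \<open>x = 0\<close>, where
  the formula for the derivative of \<open>log_Phi1\<close> is \<open>0 / 0\<close>.
\<close>

lemma eq_from_derivative_and_limit:
  fixes f g :: "complex \<Rightarrow> complex"
  assumes S: "connected S" "open S" "finite K"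
    and cont: "continuous_on S f" "continuous_on S g"
    and deriv: "\<And>x. x \<in> S - K \<Longrightarrow> \<exists>D. (f has_field_derivative D) (at x) \<and> (g has_field_derivative D) (at x)"
    and F: "F \<noteq> bot" "\<forall>\<^sub>F s in F. p s \<in> S"
    and lim: "((\<lambda>s. f (p s)) \<longlongrightarrow> l) F" "((\<lambda>s. g (p s)) \<longlongrightarrow> l) F"
    and "x \<in> S"
  shows "f x = g x"
proof -
  obtain c where c: "\<And>x. x \<in> S \<Longrightarrow> f x - g x = c"
  proof (rule DERIV_zero_connected_constant[OF S])
    show "continuous_on S (\<lambda>x. f x - g x)" using cont by (intro continuous_intros)
    show "\<forall>x\<in>S - K. ((\<lambda>x. f x - g x) has_field_derivative 0) (at x)"
    proof
      fix x assume "x \<in> S - K"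
      then obtain D where "(f has_field_derivative D) (at x)" "(g has_field_derivative D) (at x)"
        using deriv by blast
      from DERIV_diff[OF this] show "((\<lambda>x. f x - g x) has_field_derivative 0) (at x)" by simp
    qed
  qed blast
  have "((\<lambda>s. f (p s) - g (p s)) \<longlongrightarrow> l - l) F"
    by (intro tendsto_diff lim)
  moreover have "((\<lambda>s. f (p s) - g (p s)) \<longlongrightarrow> c) F"
    by (rule tendsto_eventually) (use F(2) c in \<open>auto elim: eventually_mono\<close>)
  ultimately have "c = 0"
    using tendsto_unique[OF F(1)] by fastforce
  with c[OF \<open>x \<in> S\<close>] show ?thesis by simp
qed

lemma continuous_on_log_Phi:
  assumes "0 < \<epsilon>" "\<epsilon> < pi"
  shows "continuous_on phi_strip (log_Phi \<epsilon>)"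
  using log_Phi_has_field_derivative_integral[OF assms]
  by (intro continuous_at_imp_continuous_on) (blast intro: DERIV_isCont)

lemma log_Phi_tendsto_0:
  assumes "0 < \<epsilon>" "\<epsilon> < pi" "\<bar>y\<bar> < 1"
  shows "((\<lambda>s. log_Phi \<epsilon> (of_real s + \<i> * of_real y)) \<longlongrightarrow> 0) at_bot"
proof -
  obtain W where W: "\<And>x. \<bar>Im x\<bar> \<le> \<bar>y\<bar> \<Longrightarrow> norm (log_Phi \<epsilon> x) \<le> W * exp (2 * \<epsilon> * Re x)"
    by (rule log_Phi_bound[OF assms(1,2), of "\<bar>y\<bar>"]) (use assms in auto)
  show ?thesis
  proof (rule Lim_null_comparison)
    show "\<forall>\<^sub>F s in at_bot. norm (log_Phi \<epsilon> (of_real s + \<i> * of_real y)) \<le> W * exp (2 * \<epsilon> * s)"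
      using W[of "of_real s + \<i> * of_real y" for s] by (intro always_eventually) simp
    show "((\<lambda>s. W * exp (2 * \<epsilon> * s)) \<longlongrightarrow> 0) at_bot"
      using assms(1) by real_asymp
  qed
qed

lemma log_Phi_tendsto_0_real:
  assumes "0 < \<epsilon>" "\<epsilon> < pi"
  shows "((\<lambda>s. log_Phi \<epsilon> (of_real s)) \<longlongrightarrow> 0) at_bot"
  using log_Phi_tendsto_0[OF assms, of 0] by simp

lemma log_Phi_contour_independent:
  assumes "0 < \<epsilon>" "\<epsilon> < pi" "0 < \<epsilon>'" "\<epsilon>' < pi" "\<bar>Im x\<bar> < 1"
  shows "log_Phi \<epsilon> x = log_Phi \<epsilon>' x"
proof (rule eq_from_derivative_and_limit[OF connected_phi_strip open_phi_strip, where K = "{0}"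
      and f = "log_Phi \<epsilon>" and g = "log_Phi \<epsilon>'" and x = x and p = complex_of_real and F = at_bot and l = 0])
  show "\<exists>D. (log_Phi \<epsilon> has_field_derivative D) (at y) \<and> (log_Phi \<epsilon>' has_field_derivative D) (at y)"
    if "y \<in> phi_strip - {0}" for y
    using log_Phi_has_field_derivative that assms by blast
qed (use assms in \<open>auto intro!: continuous_on_log_Phi log_Phi_tendsto_0_real\<close>)

text \<open>
  The height \<open>\<pi> / 2\<close> is an arbitrary choice in \<open>(0, \<pi>)\<close>; by contour independence it gives the exponent for
  every admissible height.
\<close>

definition log_Phi1 :: "complex \<Rightarrow> complex"
  where "log_Phi1 = log_Phi (pi / 2)"

lemma log_Phi1_has_field_derivative:
  fixes x :: complex
  assumes "\<bar>Im x\<bar> < 1" "x \<noteq> 0"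
  shows "(log_Phi1 has_field_derivative - 2 * pi * \<i> * x / (exp (- 2 * pi * x) - 1)) (at x)"
  unfolding log_Phi1_def using log_Phi_has_field_derivative[of "pi / 2"] assms by simp

lemma log_Phi1_differentiable: "\<bar>Im x\<bar> < 1 \<Longrightarrow> \<exists>D. (log_Phi1 has_field_derivative D) (at x)"
  unfolding log_Phi1_def using log_Phi_has_field_derivative_integral[of "pi / 2" x] by auto

lemma log_Phi1_holomorphic: "log_Phi1 holomorphic_on phi_strip"
  using log_Phi1_differentiable by (auto simp: holomorphic_on_open[OF open_phi_strip])

lemma continuous_on_log_Phi1: "continuous_on phi_strip log_Phi1"
  by (rule holomorphic_on_imp_continuous_on[OF log_Phi1_holomorphic])

lemma exp_2pi_eq_1_iff:
  fixes x :: complex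
  assumes "\<bar>Im x\<bar> < 1" shows "exp (2 * pi * x) = 1 \<longleftrightarrow> x = 0"
  using exp_eq_1_strip[of "2 * pi * x"] assms by (auto simp: abs_mult)

lemma exp_2pi_minus_i:
  fixes x :: complex
  shows "exp (2 * pi * (x - \<i>)) = exp (2 * pi * x)"
  using exp_plus_2pin[of "2 * pi * x" "-1"] by (simp add: algebra_simps)

text \<open>
  Passing from \<open>x\<close> to \<open>x - \<i>\<close> leaves \<open>exp (- 2 \<pi> x)\<close> fixed, so the two logarithmic derivatives differ by
  \<open>- 2 \<pi> / (exp (- 2 \<pi> x) - 1)\<close>, the logarithmic derivative of \<open>1 - exp (2 \<pi> x)\<close>.  The quotient of
  the two sides is therefore constant, and it tends to \<open>1\<close> on the line \<open>Im x = 1/2\<close> as \<open>Re x\<close> tends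
  to minus infinity.
\<close>

theorem log_Phi1_functional_equation:
  fixes x :: complex
  assumes "0 < Im x" "Im x < 1"
  shows "exp (log_Phi1 (x - \<i>)) = (1 - exp (2 * pi * x)) * exp (log_Phi1 x)"
proof -
  let ?T = "{x. 0 < Im x \<and> Im x < 1}"
  let ?q = "\<lambda>x. exp (log_Phi1 (x - \<i>) - log_Phi1 x) / (1 - exp (2 * of_real pi * x))"
  have nz: "exp (2 * of_real pi * x) \<noteq> 1" if "x \<in> ?T" for x
    using exp_2pi_eq_1_iff[of x] that by auto
  have deriv: "(?q has_field_derivative 0) (at x)" if x: "x \<in> ?T" for x
  proof -
    define e where "e = exp (2 * pi * x)"
    have e: "e \<noteq> 0" "e \<noteq> 1" using nz[OF x] by (simp_all add: e_def)
    have w: "exp (- 2 * pi * x) = 1 / e" "exp (- 2 * pi * (x - \<i>)) = 1 / e"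
      using exp_2pi_minus_i[of x] by (simp_all add: e_def exp_minus divide_inverse)
    have d1: "((\<lambda>x. log_Phi1 (x - \<i>)) has_field_derivative - 2 * pi * \<i> * (x - \<i>) / (1 / e - 1)) (at x)"
      using DERIV_chain2[OF log_Phi1_has_field_derivative[of "x - \<i>"] DERIV_diff[OF DERIV_ident DERIV_const[of \<i>]]] x
      unfolding w by (auto simp: complex_eq_iff)
    have d2: "(log_Phi1 has_field_derivative - 2 * pi * \<i> * x / (1 / e - 1)) (at x)"
      using log_Phi1_has_field_derivative[of x] x unfolding w by (auto simp: complex_eq_iff)
    have "(?q has_field_derivative
        ((exp (log_Phi1 (x - \<i>) - log_Phi1 x) * (- 2 * pi * \<i> * (x - \<i>) / (1 / e - 1) - - 2 * pi * \<i> * x / (1 / e - 1)))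
          * (1 - exp (2 * of_real pi * x)) - exp (log_Phi1 (x - \<i>) - log_Phi1 x) * (- (exp (2 * of_real pi * x) * (2 * pi))))
        / ((1 - exp (2 * of_real pi * x)) * (1 - exp (2 * of_real pi * x)))) (at x)"
      by (rule derivative_eq_intros d1 d2 refl | use nz[OF x] in simp)+
    moreover have "- 2 * pi * \<i> * (x - \<i>) / (1 / e - 1) - - 2 * pi * \<i> * x / (1 / e - 1) = - (2 * pi * e) / (1 - e)"
      using e by (simp add: divide_simps) (simp add: algebra_simps)
    moreover have "exp (2 * of_real pi * x) = e" by (simp add: e_def)
    ultimately show ?thesis using e by simp
  qed
  have "?q x = 1"
  proof (rule eq_from_derivative_and_limit[where K = "{}" and S = ?T and x = x and f = ?q and g = "\<lambda>_. 1"
      and p = "\<lambda>s. complex_of_real s + \<i> * of_real (1/2)" and F = at_bot and l = 1])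
    show "continuous_on ?T ?q"
      using deriv by (intro continuous_at_imp_continuous_on) (blast intro: DERIV_isCont)
    have eq: "complex_of_real s + \<i> * of_real (1/2) - \<i> = of_real s + \<i> * of_real (-1/2)" for s
      by (simp add: complex_eq_iff)
    have "((\<lambda>s. ?q (complex_of_real s + \<i> * of_real (1/2))) \<longlongrightarrow> exp (0 - 0) / (1 - 0)) at_bot"
    proof (intro tendsto_intros)
      show "((\<lambda>s. log_Phi1 (complex_of_real s + \<i> * of_real (1/2) - \<i>)) \<longlongrightarrow> 0) at_bot"
        unfolding eq log_Phi1_def by (intro log_Phi_tendsto_0) auto
      show "((\<lambda>s. log_Phi1 (complex_of_real s + \<i> * of_real (1/2))) \<longlongrightarrow> 0) at_bot"
        unfolding log_Phi1_def by (intro log_Phi_tendsto_0) auto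
      have "((\<lambda>s. exp (2 * pi * s)) \<longlongrightarrow> 0) at_bot" by real_asymp
      then show "((\<lambda>s. exp (2 * of_real pi * (complex_of_real s + \<i> * of_real (1/2)))) \<longlongrightarrow> 0) at_bot"
        by (intro tendsto_norm_zero_cancel[of "\<lambda>s. exp (2 * of_real pi * (complex_of_real s + \<i> * of_real (1/2)))"]) simp
    qed auto
    then show "((\<lambda>s. ?q (complex_of_real s + \<i> * of_real (1/2))) \<longlongrightarrow> 1) at_bot" by simp
    show "\<exists>D. (?q has_field_derivative D) (at y) \<and> ((\<lambda>_. 1) has_field_derivative D) (at y)" if "y \<in> ?T - {}" for y
      using deriv[of y] that by auto
  qed (use assms in \<open>auto intro!: open_Im_strip connected_Im_strip\<close>)
  then show ?thesis
    using nz[of x] assms by (simp add: exp_diff field_simps)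
qed

text \<open>
  Both sides have derivative \<open>2 \<pi> \<i> x\<close> away from \<open>0\<close> and agree at \<open>0\<close>.
\<close>

theorem log_Phi1_inversion:
  fixes x :: complex
  assumes "\<bar>Im x\<bar> < 1"
  shows "log_Phi1 x + log_Phi1 (- x) = pi * \<i> * x ^ 2 + 2 * log_Phi1 0"
proof (rule eq_from_derivative_and_limit[OF connected_phi_strip open_phi_strip, where K = "{0}" and x = x
      and f = "\<lambda>x. log_Phi1 x + log_Phi1 (- x)" and g = "\<lambda>x. pi * \<i> * x ^ 2 + 2 * log_Phi1 0"
      and p = "\<lambda>x. x" and F = "at 0" and l = "2 * log_Phi1 0"])
  have neg: "continuous_on phi_strip (\<lambda>x. log_Phi1 (- x))"
    by (rule continuous_on_compose2[OF continuous_on_log_Phi1]) (auto intro!: continuous_intros)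
  show c: "continuous_on phi_strip (\<lambda>x. log_Phi1 x + log_Phi1 (- x))"
    by (intro continuous_intros continuous_on_log_Phi1 neg)
  show "\<forall>\<^sub>F s in at 0. s \<in> phi_strip"
    using open_phi_strip by (intro eventually_at_in_open') auto
  have "isCont (\<lambda>x. log_Phi1 x + log_Phi1 (- x)) 0"
    using c open_phi_strip by (simp add: continuous_on_eq_continuous_at)
  then show "((\<lambda>x. log_Phi1 x + log_Phi1 (- x)) \<longlongrightarrow> 2 * log_Phi1 0) (at 0)"
    by (simp add: isCont_def)
  have "isCont (\<lambda>x. pi * \<i> * x ^ 2 + 2 * log_Phi1 0) 0"
    by (intro continuous_intros)
  then show "((\<lambda>x. pi * \<i> * x ^ 2 + 2 * log_Phi1 0) \<longlongrightarrow> 2 * log_Phi1 0) (at 0)"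
    by (simp add: isCont_def)
  fix y :: complex assume y: "y \<in> phi_strip - {0}"
  define e where "e = exp (2 * pi * y)"
  have e: "e \<noteq> 0" "e \<noteq> 1" using y exp_2pi_eq_1_iff[of y] by (auto simp: e_def)
  have w: "exp (- 2 * pi * y) = 1 / e" "exp (- 2 * pi * (- y)) = e"
    by (simp_all add: e_def exp_minus divide_inverse)
  have d1: "(log_Phi1 has_field_derivative - 2 * pi * \<i> * y / (1 / e - 1)) (at y)"
    using log_Phi1_has_field_derivative[of y] y unfolding w by auto
  have d2: "((\<lambda>y. log_Phi1 (- y)) has_field_derivative - 2 * pi * \<i> * (- y) / (e - 1) * (- 1)) (at y)"
    using DERIV_chain2[OF log_Phi1_has_field_derivative[of "- y"] DERIV_minus[OF DERIV_ident]] y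
    unfolding w by auto
  have "- 2 * pi * \<i> * y / (1 / e - 1) + - 2 * pi * \<i> * (- y) / (e - 1) * (- 1) = pi * \<i> * (2 * y)"
    using e by (simp add: divide_simps) (simp add: algebra_simps)
  with DERIV_add[OF d1 d2]
  have "((\<lambda>x. log_Phi1 x + log_Phi1 (- x)) has_field_derivative pi * \<i> * (2 * y)) (at y)" by simp
  moreover have "((\<lambda>x. pi * \<i> * x ^ 2 + 2 * log_Phi1 0) has_field_derivative pi * \<i> * (2 * y)) (at y)"
    by (auto intro!: derivative_eq_intros)
  ultimately show "\<exists>D. ((\<lambda>x. log_Phi1 x + log_Phi1 (- x)) has_field_derivative D) (at y)
      \<and> ((\<lambda>x. pi * \<i> * x ^ 2 + 2 * log_Phi1 0) has_field_derivative D) (at y)"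
    by blast
qed (use assms in \<open>auto intro!: continuous_intros\<close>)

lemma Li2_eq_power_series: "norm z \<le> 1 \<Longrightarrow> Li2 z = (\<Sum>n. 1 / of_nat n ^ 2 * z ^ n)"
  and summable_Li2: "norm z \<le> 1 \<Longrightarrow> summable (\<lambda>n. 1 / of_nat n ^ 2 * z ^ n :: complex)"
proof -
  have summable: "summable (\<lambda>n. 1 / of_nat n ^ 2 * z ^ n)" if "norm z \<le> 1" for z :: complex
  proof (rule summable_comparison_test'[where N = 0])
    show "summable (\<lambda>n. 1 / real n ^ 2)"
      using inverse_power_summable[of 2, where 'a = real] by (simp add: divide_inverse)
    show "norm (1 / of_nat n ^ 2 * z ^ n) \<le> 1 / real n ^ 2" for n
      using power_le_one[OF norm_ge_zero that, of n]
      by (simp add: norm_mult norm_divide norm_power divide_right_mono)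
  qed
  show "norm z \<le> 1 \<Longrightarrow> summable (\<lambda>n. 1 / of_nat n ^ 2 * z ^ n :: complex)"
    by (rule summable)
  show "norm z \<le> 1 \<Longrightarrow> Li2 z = (\<Sum>n. 1 / of_nat n ^ 2 * z ^ n)"
    using suminf_split_head[OF summable] by (simp add: Li2_def mult.commute)
qed

lemma continuous_on_Li2: "continuous_on (cball 0 1) Li2"
proof -
  have "uniform_limit (cball 0 1) (\<lambda>n z. \<Sum>i<n. z ^ Suc i / of_nat (Suc i) ^ 2 :: complex)
      (\<lambda>z. suminf (\<lambda>i. z ^ Suc i / of_nat (Suc i) ^ 2)) sequentially"
  proof (rule Weierstrass_m_test)
    show "summable (\<lambda>n. 1 / real (Suc n) ^ 2)"
      using inverse_power_summable[of 2, where 'a = real]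
      by (subst summable_Suc_iff[where f = "\<lambda>n. 1 / real n ^ 2"]) (simp add: divide_inverse)
    show "norm (z ^ Suc n / of_nat (Suc n) ^ 2) \<le> 1 / real (Suc n) ^ 2" if "z \<in> cball 0 1" for n and z :: complex
      using power_le_one[OF norm_ge_zero, of z "Suc n"] that
      by (simp add: norm_divide norm_power norm_mult divide_right_mono del: of_nat_Suc power_Suc)
  qed
  then show ?thesis
    unfolding Li2_def[abs_def]
    by (rule uniform_limit_theorem[rotated]) (auto intro!: always_eventually continuous_intros simp del: of_nat_Suc)
qed

lemma Li2_has_field_derivative:
  assumes "norm z < 1"
  obtains D where "(Li2 has_field_derivative D) (at z)" "z * D = - Ln (1 - z)"
proof -
  define c where "c = (\<lambda>n. 1 / of_nat n ^ 2 :: complex)"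
  have ps: "((\<lambda>z. \<Sum>n. c n * z ^ n) has_field_derivative (\<Sum>n. diffs c n * z ^ n)) (at z)"
    by (rule termdiffs_strong'[where K = 1]) (use summable_Li2 assms in \<open>auto simp: c_def\<close>)
  have ev: "\<forall>\<^sub>F w in nhds z. (\<Sum>n. c n * w ^ n) = Li2 w"
    using Li2_eq_power_series assms eventually_nhds_in_open[of "ball 0 1" z]
    by (auto elim!: eventually_mono simp: c_def)
  have deriv: "(Li2 has_field_derivative (\<Sum>n. diffs c n * z ^ n)) (at z)"
    by (rule DERIV_cong_ev[OF refl ev refl, THEN iffD1, OF ps])
  have "summable (\<lambda>n. diffs c n * z ^ n)"
    by (rule termdiff_converges[where K = 1]) (use summable_Li2 assms in \<open>auto simp: c_def\<close>)
  then have "z * (\<Sum>n. diffs c n * z ^ n) = (\<Sum>n. z * (diffs c n * z ^ n))"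
    by (rule suminf_mult[symmetric])
  also have "(\<lambda>n. z * (diffs c n * z ^ n)) = (\<lambda>n. z ^ Suc n / of_nat (Suc n))"
    by (auto simp: fun_eq_iff diffs_def c_def power2_eq_square divide_simps simp del: of_nat_Suc)
  also have "suminf (\<lambda>n. z ^ Suc n / of_nat (Suc n)) = - Ln (1 - z)"
  proof -
    have "(\<lambda>n. - (z ^ n / of_nat n)) sums Ln (1 - z)"
      using Ln_series'[of "- z"] assms by simp
    then have "(\<lambda>n. z ^ n / of_nat n) sums - Ln (1 - z)"
      using sums_minus by fastforce
    then have "(\<lambda>n. z ^ Suc n / of_nat (Suc n)) sums - Ln (1 - z)"
      by (subst sums_Suc_iff) simp
    then show ?thesis by (rule sums_unique[symmetric])
  qed
  finally show ?thesis using deriv that by blast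
qed

text \<open>
  By \<open>z * Li2' z = - Ln (1 - z)\<close> the logarithms produced by the two summands cancel in the derivative
  of the right-hand side, and what is left is the derivative of \<open>log_Phi1\<close>.  Both sides vanish in the
  limit along the negative real axis.
\<close>

theorem log_Phi1_dilogarithm:
  fixes x :: complex
  assumes "Re x < 0" "\<bar>Im x\<bar> < 1"
  shows "log_Phi1 x = \<i> / (2 * of_real pi)
    * (Li2 (exp (2 * of_real pi * x)) + 2 * of_real pi * x * Ln (1 - exp (2 * of_real pi * x)))"
proof -
  let ?S = "{x. Re x < 0} \<inter> {x. -1 < Im x \<and> Im x < 1}"
  let ?e = "\<lambda>x :: complex. exp (2 * of_real pi * x)"
  let ?g = "\<lambda>x :: complex. \<i> / (2 * of_real pi) * (Li2 (?e x) + 2 * of_real pi * x * Ln (1 - ?e x))"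
  have norm_e: "norm (?e x) < 1" if "x \<in> ?S" for x
    using that by (simp add: mult_pos_neg)
  have Re_pos: "Re (1 - ?e x) > 0" if "x \<in> ?S" for x
    using norm_e[OF that] complex_Re_le_cmod[of "?e x"] by (simp del: norm_exp_eq_Re)
  have deriv: "(?g has_field_derivative - 2 * pi * \<i> * x / (exp (- 2 * pi * x) - 1)) (at x)" if x: "x \<in> ?S" for x :: complex
  proof -
    define e where "e = ?e x"
    have e: "e \<noteq> 0" "e \<noteq> 1" using norm_e[OF x] by (auto simp: e_def simp del: norm_exp_eq_Re)
    have w: "exp (- 2 * pi * x) = 1 / e" by (simp add: e_def exp_minus divide_inverse)
    obtain D where D: "(Li2 has_field_derivative D) (at e)" "e * D = - Ln (1 - e)"
      using Li2_has_field_derivative[of e] norm_e[OF x] unfolding e_def by blast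
    have de: "(?e has_field_derivative e * (2 * pi)) (at x)"
      unfolding e_def by (auto intro!: derivative_eq_intros)
    have dLi: "((\<lambda>x. Li2 (?e x)) has_field_derivative D * (e * (2 * pi))) (at x)"
      using DERIV_chain2[OF D(1)[unfolded e_def] de] .
    have dLn: "((\<lambda>x. Ln (1 - ?e x)) has_field_derivative - (e * (2 * pi)) / (1 - e)) (at x)"
      using Re_pos[OF x] unfolding e_def
      by (auto intro!: derivative_eq_intros simp: complex_nonpos_Reals_iff divide_simps)
    have lin: "((\<lambda>x. 2 * of_real pi * x) has_field_derivative 2 * of_real pi) (at x)"
      by (auto intro!: derivative_eq_intros)
    have "(?g has_field_derivative \<i> / (2 * of_real pi) * (D * (e * (2 * pi))
        + (2 * of_real pi * Ln (1 - e) + - (e * (2 * pi)) / (1 - e) * (2 * of_real pi * x)))) (at x)"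
      unfolding e_def
      by (rule DERIV_cmult[OF DERIV_add[OF dLi[unfolded e_def] DERIV_mult[OF lin dLn[unfolded e_def]]]])
    moreover have "\<i> / (2 * of_real pi) * (D * (e * (2 * pi))
        + (2 * of_real pi * Ln (1 - e) + - (e * (2 * pi)) / (1 - e) * (2 * of_real pi * x)))
        = - 2 * pi * \<i> * x / (exp (- 2 * pi * x) - 1)"
    proof -
      have "\<i> / (2 * p) * (- l * (2 * p) + (2 * p * l + - (e * (2 * p)) / (1 - e) * (2 * p * x)))
        = - 2 * p * \<i> * x / (1 / e - 1)" if "p \<noteq> 0" for p l :: complex
      proof -
        have "- l * (2 * p) + (2 * p * l + - (e * (2 * p)) / (1 - e) * (2 * p * x)) = - (e * (2 * p)) / (1 - e) * (2 * p * x)"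
          by (simp add: algebra_simps)
        also have "\<i> / (2 * p) * \<dots> = - 2 * p * \<i> * x / (1 / e - 1)"
          using that e by (simp add: divide_simps)
        finally show ?thesis .
      qed
      from this[of "of_real pi" "Ln (1 - e)"] show ?thesis
        unfolding w mult.assoc[symmetric] mult.commute[of D e] D(2) by simp
    qed
    ultimately show ?thesis by (simp only:)
  qed
  have "log_Phi1 x = ?g x"
  proof (rule eq_from_derivative_and_limit[where K = "{}" and S = ?S and x = x and f = log_Phi1 and g = ?g
      and p = complex_of_real and F = at_bot and l = 0])
    show "connected ?S"
      unfolding Im_strip_eq
      by (intro convex_connected convex_Int convex_halfspace_Im_lt convex_halfspace_Im_gt convex_halfspace_Re_lt)
    show "open ?S" by (intro open_Int open_halfspace_Re_lt open_Im_strip)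
    show "continuous_on ?S log_Phi1"
      by (rule continuous_on_subset[OF continuous_on_log_Phi1]) auto
    show "continuous_on ?S ?g"
      using deriv by (intro continuous_at_imp_continuous_on) (blast intro: DERIV_isCont)
    show "\<exists>D. (log_Phi1 has_field_derivative D) (at y) \<and> (?g has_field_derivative D) (at y)" if "y \<in> ?S - {}" for y
    proof (intro exI conjI)
      show "(?g has_field_derivative - 2 * pi * \<i> * y / (exp (- 2 * pi * y) - 1)) (at y)"
        using that by (intro deriv) auto
      show "(log_Phi1 has_field_derivative - 2 * pi * \<i> * y / (exp (- 2 * pi * y) - 1)) (at y)"
        using that by (intro log_Phi1_has_field_derivative) auto
    qed
    show "\<forall>\<^sub>F s in at_bot. complex_of_real s \<in> ?S"
      by (auto intro: eventually_mono[OF eventually_gt_at_bot[of 0]])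
    show "((\<lambda>s. log_Phi1 (of_real s)) \<longlongrightarrow> 0) at_bot"
      unfolding log_Phi1_def by (rule log_Phi_tendsto_0_real) auto
    have e0: "((\<lambda>s. ?e (complex_of_real s)) \<longlongrightarrow> 0) at_bot"
    proof (rule tendsto_norm_zero_cancel)
      show "((\<lambda>s. norm (?e (complex_of_real s))) \<longlongrightarrow> 0) at_bot" by simp real_asymp
    qed
    have "isCont Li2 0"
      using continuous_on_Li2 by (auto simp: continuous_on_interior)
    then have "((\<lambda>s. Li2 (?e (complex_of_real s))) \<longlongrightarrow> 0) at_bot"
      using isCont_tendsto_compose[OF _ e0] by (fastforce simp: Li2_def)
    moreover have "((\<lambda>s. 2 * of_real pi * of_real s * Ln (1 - ?e (complex_of_real s))) \<longlongrightarrow> 0) at_bot"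
    proof (rule Lim_transform_eventually)
      have "((\<lambda>s. 2 * pi * s * ln (1 - exp (2 * pi * s))) \<longlongrightarrow> 0) at_bot" by real_asymp
      from tendsto_of_real[OF this]
      show "((\<lambda>s. complex_of_real (2 * pi * s * ln (1 - exp (2 * pi * s)))) \<longlongrightarrow> 0) at_bot" by simp
      show "\<forall>\<^sub>F s in at_bot. complex_of_real (2 * pi * s * ln (1 - exp (2 * pi * s)))
          = 2 * of_real pi * of_real s * Ln (1 - ?e (complex_of_real s))"
        using eventually_gt_at_bot[of 0]
      proof eventually_elim
        case (elim s)
        then have "0 < 1 - exp (2 * pi * s)" by (simp add: mult_pos_neg)
        then have "Ln (complex_of_real (1 - exp (2 * pi * s))) = of_real (ln (1 - exp (2 * pi * s)))"
          by (rule Ln_of_real)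
        then show ?case by (simp flip: exp_of_real)
      qed
    qed
    ultimately have "((\<lambda>s. ?g (complex_of_real s)) \<longlongrightarrow> \<i> / (2 * of_real pi) * (0 + 0)) at_bot"
      by (rule tendsto_mult[OF tendsto_const tendsto_add])
    then show "((\<lambda>s. ?g (complex_of_real s)) \<longlongrightarrow> 0) at_bot" by simp
  qed (use assms in auto)
  then show ?thesis by simp
qed

text \<open>
  Boundary values of the dilogarithm formula: \<open>Li2\<close> is continuous on the closed disc, and \<open>1 - z\<close>
  stays in the right half plane for \<open>z \<noteq> 1\<close> on the unit circle.
\<close>

lemma log_Phi1_imaginary_axis:
  fixes y :: real
  assumes "\<bar>y\<bar> < 1" "y \<noteq> 0"
  shows "log_Phi1 (\<i> * y) = \<i> / (2 * pi) * (Li2 (exp (2 * pi * \<i> * y))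
    + 2 * pi * \<i> * y * Ln (1 - exp (2 * pi * \<i> * y)))"
proof -
  let ?p = "\<lambda>s. complex_of_real s + \<i> * of_real y"
  let ?e = "\<lambda>x :: complex. exp (2 * of_real pi * x)"
  let ?g = "\<lambda>x :: complex. \<i> / (2 * of_real pi) * (Li2 (?e x) + 2 * of_real pi * x * Ln (1 - ?e x))"
  have p: "(?p \<longlongrightarrow> \<i> * of_real y) (at_left 0)" by (auto intro!: tendsto_eq_intros)
  have e: "((\<lambda>s. ?e (?p s)) \<longlongrightarrow> ?e (\<i> * of_real y)) (at_left 0)"
    by (intro tendsto_intros p)
  have norm_e: "norm (?e (\<i> * of_real y)) = 1" by simp
  have "Re (?e (\<i> * of_real y)) \<noteq> 1"
  proof
    assume "Re (?e (\<i> * of_real y)) = 1"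
    then have "?e (\<i> * of_real y) = 1"
      using norm_e cmod_power2[of "?e (\<i> * of_real y)"] by (simp only:) (simp add: complex_eq_iff)
    then show False using exp_2pi_eq_1_iff[of "\<i> * of_real y"] assms by simp
  qed
  then have Re_pos: "Re (1 - ?e (\<i> * of_real y)) > 0"
    using norm_e complex_Re_le_cmod[of "?e (\<i> * of_real y)"] by simp
  have neg: "\<forall>\<^sub>F s in at_left (0::real). s < 0"
    by (simp add: eventually_at_filter)
  have "((\<lambda>s. Li2 (?e (?p s))) \<longlongrightarrow> Li2 (?e (\<i> * of_real y))) (at_left 0)"
    by (rule continuous_on_tendsto_compose[OF continuous_on_Li2 e])
      (use neg in \<open>auto elim!: eventually_mono simp: mult_nonpos_nonneg\<close>)
  moreover have Ln_lim: "((\<lambda>s. Ln (1 - ?e (?p s))) \<longlongrightarrow> Ln (1 - ?e (\<i> * of_real y))) (at_left 0)"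
  proof (intro tendsto_intros e p)
    show "1 - ?e (\<i> * of_real y) \<notin> \<real>\<^sub>\<le>\<^sub>0"
      using Re_pos unfolding complex_nonpos_Reals_iff by linarith
  qed
  ultimately have "((\<lambda>s. ?g (?p s)) \<longlongrightarrow> ?g (\<i> * of_real y)) (at_left 0)"
    by (intro tendsto_mult[OF tendsto_const tendsto_add] tendsto_mult[OF tendsto_mult[OF tendsto_const p] Ln_lim])
  moreover have "((\<lambda>s. ?g (?p s)) \<longlongrightarrow> log_Phi1 (\<i> * of_real y)) (at_left 0)"
  proof (rule Lim_transform_eventually)
    show "((\<lambda>s. log_Phi1 (?p s)) \<longlongrightarrow> log_Phi1 (\<i> * of_real y)) (at_left 0)"
      by (rule continuous_on_tendsto_compose[OF continuous_on_log_Phi1 p]) (use assms in auto)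
    show "\<forall>\<^sub>F s in at_left 0. log_Phi1 (?p s) = ?g (?p s)"
      using neg by eventually_elim (use assms log_Phi1_dilogarithm in simp)
  qed
  ultimately have "log_Phi1 (\<i> * of_real y) = ?g (\<i> * of_real y)"
    using tendsto_unique[OF trivial_limit_at_left_real] by blast
  then show ?thesis by (simp add: mult_ac)
qed

text \<open>
  At the origin the logarithm in the dilogarithm formula diverges, but its factor \<open>x\<close> wins, and
  \<open>Li2 1 = \<pi>^2 / 6\<close> remains.
\<close>

lemma log_Phi1_0: "log_Phi1 0 = pi * \<i> / 12"
proof -
  let ?e = "\<lambda>s. exp (2 * of_real pi * complex_of_real s)"
  have neg: "\<forall>\<^sub>F s in at_left (0::real). s < 0"
    by (simp add: eventually_at_filter)
  have e: "(?e \<longlongrightarrow> 1) (at_left 0)"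
    by (auto intro!: tendsto_eq_intros)
  have Li2_1: "Li2 1 = of_real (pi ^ 2 / 6)"
  proof -
    have "(\<lambda>n. complex_of_real (1 / real (n + 1) ^ 2)) sums of_real (pi ^ 2 / 6)"
      using inverse_squares_sums by (simp only: sums_of_real_iff of_nat_power)
    then show ?thesis unfolding Li2_def by (simp add: sums_iff)
  qed
  have "((\<lambda>s. Li2 (?e s)) \<longlongrightarrow> Li2 1) (at_left 0)"
    by (rule continuous_on_tendsto_compose[OF continuous_on_Li2 e])
      (use neg in \<open>auto elim!: eventually_mono simp: mult_nonpos_nonneg\<close>)
  moreover have "((\<lambda>s. 2 * of_real pi * of_real s * Ln (1 - ?e s)) \<longlongrightarrow> 0) (at_left 0)"
  proof (rule Lim_transform_eventually)
    have "((\<lambda>s. 2 * pi * s * ln (1 - exp (2 * pi * s))) \<longlongrightarrow> 0) (at_left 0)" by real_asymp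
    from tendsto_of_real[OF this]
    show "((\<lambda>s. complex_of_real (2 * pi * s * ln (1 - exp (2 * pi * s)))) \<longlongrightarrow> 0) (at_left 0)" by simp
    show "\<forall>\<^sub>F s in at_left 0. complex_of_real (2 * pi * s * ln (1 - exp (2 * pi * s)))
        = 2 * of_real pi * of_real s * Ln (1 - ?e s)"
      using neg
    proof eventually_elim
      case (elim s)
      then have "0 < 1 - exp (2 * pi * s)" by (simp add: mult_pos_neg)
      then have "Ln (complex_of_real (1 - exp (2 * pi * s))) = of_real (ln (1 - exp (2 * pi * s)))"
        by (rule Ln_of_real)
      then show ?case by (simp flip: exp_of_real)
    qed
  qed
  ultimately have "((\<lambda>s. \<i> / (2 * of_real pi) * (Li2 (?e s) + 2 * of_real pi * of_real s * Ln (1 - ?e s)))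
      \<longlongrightarrow> \<i> / (2 * of_real pi) * (Li2 1 + 0)) (at_left 0)"
    by (rule tendsto_mult[OF tendsto_const tendsto_add])
  moreover have "((\<lambda>s. \<i> / (2 * of_real pi) * (Li2 (?e s) + 2 * of_real pi * of_real s * Ln (1 - ?e s)))
      \<longlongrightarrow> log_Phi1 0) (at_left 0)"
  proof (rule Lim_transform_eventually)
    show "((\<lambda>s. log_Phi1 (of_real s)) \<longlongrightarrow> log_Phi1 0) (at_left 0)"
      by (rule continuous_on_tendsto_compose[OF continuous_on_log_Phi1])
        (auto intro!: tendsto_eq_intros)
    show "\<forall>\<^sub>F s in at_left 0. log_Phi1 (of_real s)
        = \<i> / (2 * of_real pi) * (Li2 (?e s) + 2 * of_real pi * of_real s * Ln (1 - ?e s))"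
      using neg by eventually_elim (use log_Phi1_dilogarithm in simp)
  qed
  ultimately have "log_Phi1 0 = \<i> / (2 * of_real pi) * (Li2 1 + 0)"
    using tendsto_unique[OF trivial_limit_at_left_real] by blast
  then show ?thesis by (simp add: Li2_1 power2_eq_square)
qed

section \<open>Meromorphic continuation\<close>

text \<open>
  Iterating the functional equation \<open>n\<close> times suggests the value \<open>Phi1(x - n \<i>) (1 - exp (2 \<pi> x))^(- n)\<close>
  at \<open>x\<close> for any \<open>n\<close> with \<open>|Im x - n| < 1\<close>; rounding selects one such \<open>n\<close>.  Integer powers of \<open>0\<close> with negative
  exponent are \<open>0\<close>, which is the value prescribed at poles.
\<close>

definition Phi1_ext :: "complex \<Rightarrow> complex"
  where "Phi1_ext x = exp (log_Phi1 (x - \<i> * of_int (round (Im x))))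
    * (1 - exp (2 * of_real pi * x)) powi (- round (Im x))"

lemma exp_2pi_minus_int: "exp (2 * of_real pi * (x - \<i> * of_int n)) = exp (2 * of_real pi * x)"
proof -
  have "2 * of_real pi * (x - \<i> * of_int n) = 2 * of_real pi * x - of_int n * (2 * of_real pi * \<i>)"
    by (simp add: algebra_simps)
  moreover have "exp (of_int n * (2 * of_real pi * \<i>)) = 1"
    unfolding exp_eq_1 by (auto intro: exI[of _ n])
  ultimately show ?thesis by (simp add: exp_diff)
qed

lemma Phi1_ext_step:
  assumes "of_int k < Im x" "Im x < of_int k + 1"
  shows "exp (log_Phi1 (x - \<i> * of_int k)) * (1 - exp (2 * of_real pi * x)) powi (- k)
    = exp (log_Phi1 (x - \<i> * of_int (k + 1))) * (1 - exp (2 * of_real pi * x)) powi (- (k + 1))"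
proof -
  define y where "y = x - \<i> * of_int k"
  define E where "E = 1 - exp (2 * of_real pi * x)"
  have y: "0 < Im y" "Im y < 1" using assms by (simp_all add: y_def)
  have Ey: "E = 1 - exp (2 * of_real pi * y)" by (simp add: E_def y_def exp_2pi_minus_int)
  have "exp (2 * of_real pi * y) \<noteq> 1"
    using exp_2pi_eq_1_iff[of y] y by auto
  then have "E \<noteq> 0" by (simp add: Ey)
  have "x - \<i> * of_int (k + 1) = y - \<i>" by (simp add: y_def algebra_simps)
  moreover have "exp (log_Phi1 (y - \<i>)) = E * exp (log_Phi1 y)"
    using log_Phi1_functional_equation[OF y] by (simp add: Ey)
  moreover have "E powi (- k) = E * E powi (- (k + 1))"
    using power_int_add[of E 1 "- (k + 1)"] \<open>E \<noteq> 0\<close> by simp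
  ultimately show ?thesis
    unfolding y_def[symmetric] E_def[symmetric] by simp
qed

text \<open>
  Any admissible \<open>n\<close> gives the same value, since two different ones are neighbours and then \<open>x\<close> lies
  strictly between the corresponding lines, where the functional equation applies.  Near a given point a
  single \<open>n\<close> can therefore be used, which makes the continuation visibly meromorphic.
\<close>

lemma Phi1_ext_eq:
  assumes "\<bar>Im x - of_int n\<bar> < 1"
  shows "Phi1_ext x = exp (log_Phi1 (x - \<i> * of_int n)) * (1 - exp (2 * of_real pi * x)) powi (- n)"
proof -
  define m where "m = round (Im x)"
  have m: "\<bar>of_int m - Im x\<bar> \<le> 1/2"
    unfolding m_def by (rule of_int_round_abs_le)
  have "m = n \<or> m = n + 1 \<or> n = m + 1" using m assms by linarith
  then show ?thesis
  proof (elim disjE)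
    assume "m = n" then show ?thesis by (simp add: Phi1_ext_def m_def)
  next
    assume mn: "m = n + 1"
    show ?thesis
      using Phi1_ext_step[of n x] m assms unfolding Phi1_ext_def m_def[symmetric] mn by simp
  next
    assume mn: "n = m + 1"
    show ?thesis
      using Phi1_ext_step[of m x] m assms unfolding Phi1_ext_def m_def[symmetric] mn by simp
  qed
qed

lemma Phi1_ext_nicely_meromorphic: "Phi1_ext nicely_meromorphic_on UNIV"
proof -
  have local: "Phi1_ext meromorphic_on {z} \<and> ((is_pole Phi1_ext z \<and> Phi1_ext z = 0) \<or> Phi1_ext \<midarrow>z\<rightarrow> Phi1_ext z)" for z
  proof -
    define n where "n = round (Im z)"
    define U where "U = {x. of_int n - 1 < Im x \<and> Im x < of_int n + 1}"
    define G where "G = (\<lambda>x. exp (log_Phi1 (x - \<i> * of_int n)) * (1 - exp (2 * of_real pi * x)) powi (- n))"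
    have "\<bar>of_int n - Im z\<bar> \<le> 1/2"
      unfolding n_def by (rule of_int_round_abs_le)
    then have "of_int n - 1 < Im z \<and> Im z < of_int n + 1" by linarith
    then have U: "open U" "z \<in> U" unfolding U_def by (auto intro: open_Im_strip)
    have eq: "Phi1_ext x = G x" if "x \<in> U" for x
      using Phi1_ext_eq[of x n] that by (auto simp: U_def G_def)
    have "\<forall>\<^sub>F x in nhds z. Phi1_ext x = G x"
      using eventually_nhds_in_open[OF U] eq by (auto elim: eventually_mono)
    then have ev': "\<forall>\<^sub>F x in at z. Phi1_ext x = G x"
      by (rule eventually_nhds_conv_at[THEN iffD1, THEN conjunct1])
    have log: "(\<lambda>x. log_Phi1 (x - \<i> * of_int n)) analytic_on U"
      unfolding analytic_on_open[OF U(1)]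
      by (rule holomorphic_on_compose_gen[OF _ log_Phi1_holomorphic, unfolded o_def])
        (auto intro!: holomorphic_intros simp: U_def)
    have "G nicely_meromorphic_on U"
    proof (cases "n \<le> 0")
      case True
      have "(\<lambda>x. exp (log_Phi1 (x - \<i> * of_int n)) * (1 - exp (2 * of_real pi * x)) ^ nat (- n)) analytic_on U"
        by (intro analytic_intros log)
      moreover have "G = (\<lambda>x. exp (log_Phi1 (x - \<i> * of_int n)) * (1 - exp (2 * of_real pi * x)) ^ nat (- n))"
        using True by (auto simp: G_def fun_eq_iff power_int_def)
      ultimately show ?thesis by (simp add: analytic_on_imp_nicely_meromorphic_on)
    next
      case False
      have "(\<lambda>x. exp (- log_Phi1 (x - \<i> * of_int n)) * (1 - exp (2 * of_real pi * x)) ^ nat n) analytic_on U"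
        by (intro analytic_intros log)
      then have "(\<lambda>x. inverse (exp (- log_Phi1 (x - \<i> * of_int n)) * (1 - exp (2 * of_real pi * x)) ^ nat n)) nicely_meromorphic_on U"
        by (intro nicely_meromorphic_on_inverse analytic_on_imp_nicely_meromorphic_on)
      moreover have "G = (\<lambda>x. inverse (exp (- log_Phi1 (x - \<i> * of_int n)) * (1 - exp (2 * of_real pi * x)) ^ nat n))"
        using False by (auto simp: G_def fun_eq_iff power_int_def exp_minus power_inverse)
      ultimately show ?thesis by simp
    qed
    then have G: "G meromorphic_on {z}" "(is_pole G z \<and> G z = 0) \<or> G \<midarrow>z\<rightarrow> G z"
      using U(2) unfolding nicely_meromorphic_on_def by (auto intro: meromorphic_on_subset)
    have "Phi1_ext meromorphic_on {z}"
      using G(1) meromorphic_on_cong[OF _ refl, of "{z}" Phi1_ext G] ev' by simp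
    moreover have "is_pole Phi1_ext z \<longleftrightarrow> is_pole G z"
      by (rule is_pole_cong) (use ev' in auto)
    moreover have "Phi1_ext \<midarrow>z\<rightarrow> Phi1_ext z \<longleftrightarrow> G \<midarrow>z\<rightarrow> G z"
      unfolding eq[OF U(2)] by (rule tendsto_cong[OF ev'])
    ultimately show ?thesis using G(2) eq[OF U(2)] by simp
  qed
  have "Phi1_ext meromorphic_on UNIV"
    unfolding meromorphic_on_meromorphic_at[of _ UNIV] using local by blast
  then show ?thesis
    unfolding nicely_meromorphic_on_def using local by blast
qed

lemma log_Phi_eq_log_Phi1:
  assumes "0 < \<epsilon>" "\<epsilon> < pi" "\<bar>Im x\<bar> < 1"
  shows "shifted_line_integral \<epsilon> (\<lambda>t. exp (- 2 * \<i> * x * t) / (4 * sinh t ^ 2) * (1 / t)) = log_Phi1 x"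
  using log_Phi_contour_independent[OF assms(1,2), of "pi / 2" x] assms
  unfolding log_Phi1_def log_Phi_def fourier_kernel_def by simp

lemma is_faddeev_Phi1_Phi1: "is_faddeev_Phi1 Phi1"
proof -
  have "is_faddeev_Phi1 Phi1_ext"
    unfolding is_faddeev_Phi1_def
  proof
    have "\<forall>\<^sub>F \<epsilon> in at_right 0. 0 < \<epsilon> \<and> \<epsilon> < pi"
      using eventually_at_right_real[OF pi_gt_zero] by simp
    then show "\<forall>\<^sub>F \<epsilon> in at_right 0. \<forall>x. \<bar>Im x\<bar> < 1 \<longrightarrow> Phi1_ext x
        = exp (shifted_line_integral \<epsilon> (\<lambda>t. exp (- 2 * \<i> * x * t) / (4 * sinh t ^ 2) * (1 / t)))"
    proof (rule eventually_mono, intro allI impI)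
      fix \<epsilon> x assume "0 < \<epsilon> \<and> \<epsilon> < pi" "\<bar>Im x\<bar> < 1"
      then show "Phi1_ext x
        = exp (shifted_line_integral \<epsilon> (\<lambda>t. exp (- 2 * \<i> * x * t) / (4 * sinh t ^ 2) * (1 / t)))"
        using Phi1_ext_eq[of x 0] by (subst log_Phi_eq_log_Phi1) auto
    qed
  qed (rule Phi1_ext_nicely_meromorphic)
  then show ?thesis unfolding Phi1_def by (rule someI[where P = is_faddeev_Phi1])
qed

text \<open>
  The continuation shows that the description of \<open>Phi1\<close> is satisfiable; whichever function the choice
  operator picks, its values in the strip are those of the integral.
\<close>

theorem Phi1_eq_exp_log_Phi1:
  assumes "\<bar>Im x\<bar> < 1" shows "Phi1 x = exp (log_Phi1 x)"
proof -
  have "\<forall>\<^sub>F \<epsilon> in at_right 0. 0 < \<epsilon> \<and> \<epsilon> < pi"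
    using eventually_at_right_real[OF pi_gt_zero] by simp
  moreover have "\<forall>\<^sub>F \<epsilon> in at_right 0. \<forall>x. \<bar>Im x\<bar> < 1 \<longrightarrow> Phi1 x
        = exp (shifted_line_integral \<epsilon> (\<lambda>t. exp (- 2 * \<i> * x * t) / (4 * sinh t ^ 2) * (1 / t)))"
    using is_faddeev_Phi1_Phi1 unfolding is_faddeev_Phi1_def by blast
  ultimately have "\<forall>\<^sub>F \<epsilon> in at_right (0::real). Phi1 x = exp (log_Phi1 x)"
    by eventually_elim (use assms log_Phi_eq_log_Phi1 in auto)
  then show ?thesis by simp
qed

section \<open>Evaluating the state integral by residues\<close>

text \<open>
  The integrand of the state integral of the knot \<open>4\<^sub>1\<close>, on the strip where \<open>Phi1\<close> is the exponential
  of \<open>log_Phi1\<close>.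
\<close>

definition integrand41 :: "complex \<Rightarrow> complex"
  where "integrand41 x = exp (2 * log_Phi1 x - of_real pi * \<i> * x ^ 2)"

text \<open>
  This is \<open>2 cosh (2 \<pi> x) - 1 = 1 - 1 / g\<close> with \<open>g = - z / (1 - z)^2\<close> and \<open>z = exp (2 \<pi> x)\<close>.
\<close>

definition denom41 :: "complex \<Rightarrow> complex"
  where "denom41 x = exp (2 * of_real pi * x) + exp (- (2 * of_real pi * x)) - 1"

lemma integrand41_eq:
  assumes "\<bar>Im x\<bar> < 1"
  shows "Phi1 x ^ 2 * exp (- of_real pi * \<i> * x ^ 2) = integrand41 x"
  using Phi1_eq_exp_log_Phi1[OF assms]
  by (simp add: integrand41_def exp_diff exp_minus divide_inverse exp_double)

text \<open>
  One factor \<open>1 - exp (2 \<pi> x)\<close> from each of the two copies of \<open>Phi1\<close> combines with the factor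
  \<open>- exp (- 2 \<pi> x)\<close> from the Gaussian.
\<close>

lemma integrand41_shift:
  assumes "0 < Im x" "Im x < 1"
  shows "integrand41 (x - \<i>) = integrand41 x * (1 - denom41 x)"
proof -
  define e where "e = exp (2 * of_real pi * x)"
  have e: "e \<noteq> 0" by (simp add: e_def)
  have log: "exp (log_Phi1 (x - \<i>)) = (1 - e) * exp (log_Phi1 x)"
    using log_Phi1_functional_equation[OF assms] by (simp add: e_def)
  have "- (of_real pi * \<i> * (x - \<i>) ^ 2) = - (of_real pi * \<i> * x ^ 2) - 2 * of_real pi * x + of_real pi * \<i>"
    by (simp add: power2_eq_square algebra_simps)
  then have gauss: "exp (- (of_real pi * \<i> * (x - \<i>) ^ 2)) = - exp (- (of_real pi * \<i> * x ^ 2)) / e"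
    by (simp add: exp_add exp_diff e_def)
  have F: "integrand41 y = exp (log_Phi1 y) ^ 2 * exp (- (of_real pi * \<i> * y ^ 2))" for y
    by (simp add: integrand41_def exp_diff exp_minus divide_inverse exp_double)
  have "integrand41 (x - \<i>) = integrand41 x * (- ((1 - e) ^ 2 / e))"
    unfolding F log gauss by (simp add: power_mult_distrib)
  also have "- ((1 - e) ^ 2 / e) = 1 - denom41 x"
    using e unfolding denom41_def exp_minus e_def[symmetric] by (simp add: field_simps power2_eq_square)
  finally show ?thesis .
qed

lemma denom41_shift: "denom41 (x - \<i>) = denom41 x"
proof -
  have "exp (2 * of_real pi * (x - \<i>)) = exp (2 * of_real pi * x)"
    using exp_2pi_minus_int[of x 1] by simp
  then show ?thesis unfolding denom41_def exp_minus by (simp only:)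
qed

text \<open>
  For \<open>Re x \<le> 0\<close> the quantum dilogarithm is bounded and the Gaussian has absolute value
  \<open>exp (2 \<pi> Re x Im x)\<close>.  For \<open>Re x \<ge> 0\<close> inversion turns \<open>F x\<close> into a bounded factor times the
  reciprocal Gaussian.
\<close>

lemma integrand41_bound:
  assumes "0 \<le> \<delta>" "\<delta> < 1"
  obtains C where "C > 0" "\<And>x. \<bar>Im x\<bar> \<le> \<delta> \<Longrightarrow> norm (integrand41 x) \<le> C * exp (- 2 * pi * \<bar>Re x\<bar> * Im x)"
proof -
  obtain W where W: "\<And>x. \<bar>Im x\<bar> \<le> \<delta> \<Longrightarrow> norm (log_Phi1 x) \<le> W * exp (pi * Re x)"
    by (rule log_Phi_bound[of "pi / 2" \<delta>]) (use assms in \<open>auto simp: log_Phi1_def\<close>)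
  have left: "\<bar>Re (log_Phi1 x)\<bar> \<le> \<bar>W\<bar>" if "\<bar>Im x\<bar> \<le> \<delta>" "Re x \<le> 0" for x
  proof -
    have "\<bar>Re (log_Phi1 x)\<bar> \<le> norm (log_Phi1 x)" by (rule abs_Re_le_cmod)
    also have "\<dots> \<le> W * exp (pi * Re x)" by (rule W) fact
    also have "\<dots> \<le> \<bar>W\<bar> * 1" using that by (intro mult_mono) (auto simp: mult_nonneg_nonpos)
    finally show ?thesis by simp
  qed
  have norm: "norm (integrand41 x) = exp (2 * Re (log_Phi1 x) + 2 * pi * Re x * Im x)" for x
    by (simp add: integrand41_def power2_eq_square algebra_simps)
  show ?thesis
  proof (rule that[of "exp (2 * \<bar>W\<bar>)"])
    fix x :: complex assume x: "\<bar>Im x\<bar> \<le> \<delta>"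
    have "2 * Re (log_Phi1 x) + 2 * pi * Re x * Im x \<le> 2 * \<bar>W\<bar> + (- 2 * pi * \<bar>Re x\<bar> * Im x)"
    proof (cases "Re x \<le> 0")
      case True
      then show ?thesis using left[OF x] by (simp add: abs_le_iff)
    next
      case False
      have "Re (log_Phi1 x + log_Phi1 (- x)) = Re (pi * \<i> * x ^ 2 + 2 * log_Phi1 0)"
        using log_Phi1_inversion[of x] x assms by simp
      then have "Re (log_Phi1 x) = - 2 * pi * Re x * Im x - Re (log_Phi1 (- x))"
        by (simp add: log_Phi1_0 power2_eq_square algebra_simps)
      moreover have "\<bar>Re (log_Phi1 (- x))\<bar> \<le> \<bar>W\<bar>" using left[of "- x"] x False by simp
      ultimately show ?thesis using False by (simp add: abs_le_iff)
    qed
    then show "norm (integrand41 x) \<le> exp (2 * \<bar>W\<bar>) * exp (- 2 * pi * \<bar>Re x\<bar> * Im x)"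
      unfolding norm exp_add[symmetric] by simp
  qed simp
qed

lemma denom41_bound:
  assumes "\<bar>Re x\<bar> \<ge> 1"
  shows "exp (2 * pi * \<bar>Re x\<bar>) / 2 \<le> norm (denom41 x)"
proof -
  define u where "u = 2 * of_real pi * x"
  have "exp \<bar>Re u\<bar> \<le> norm (exp u + exp (- u)) + exp (- \<bar>Re u\<bar>)"
    using norm_triangle_ineq4[of "exp u + exp (- u)" "exp (- u)"] norm_triangle_ineq4[of "exp u + exp (- u)" "exp u"]
    by (cases "Re u \<ge> 0") auto
  moreover have "norm (exp u + exp (- u)) \<le> norm (denom41 x) + 1"
    using norm_triangle_ineq[of "denom41 x" 1] by (simp add: denom41_def u_def)
  moreover have "exp (- \<bar>Re u\<bar>) \<le> 1" by simp
  moreover have "exp \<bar>Re u\<bar> \<ge> 4"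
  proof -
    have "2 * pi * 1 \<le> 2 * pi * \<bar>Re x\<bar>" using assms by (intro mult_left_mono) auto
    then have "3 < 2 * pi * \<bar>Re x\<bar>" using pi_gt3 by linarith
    moreover have "\<bar>Re u\<bar> = 2 * pi * \<bar>Re x\<bar>" by (simp add: u_def abs_mult)
    ultimately show ?thesis using exp_ge_add_one_self[of "\<bar>Re u\<bar>"] by linarith
  qed
  moreover have "exp (2 * pi * \<bar>Re x\<bar>) = exp \<bar>Re u\<bar>" by (simp add: u_def abs_mult)
  ultimately show ?thesis by linarith
qed

lemma exp_pi_third: "exp (of_real pi * \<i> / 3) = Complex (1/2) (sqrt 3 / 2)"
proof -
  have "exp (of_real pi * \<i> / 3) = cis (pi / 3)" by (simp add: cis_conv_exp mult.commute)
  then show ?thesis by (simp add: complex_eq_iff cos_60 sin_60)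
qed

lemma exp_minus_pi_third: "exp (- (of_real pi * \<i> / 3)) = Complex (1/2) (- sqrt 3 / 2)"
proof -
  have "exp (- (of_real pi * \<i> / 3)) = cis (- (pi / 3))" by (simp add: cis_conv_exp mult.commute)
  then show ?thesis by (simp add: complex_eq_iff cos_60 sin_60)
qed

lemma exp_2pi_eq_iff:
  "exp (2 * of_real pi * w) = exp (2 * of_real pi * (\<i> * of_real r)) \<longleftrightarrow> (\<exists>n::int. w = \<i> * of_real (of_int n + r))"
proof -
  have "2 * of_real pi * w = 2 * of_real pi * (\<i> * of_real r) + of_real (real_of_int (2 * n) * pi) * \<i>
      \<longleftrightarrow> w = \<i> * of_real (of_int n + r)" for n :: int
  proof -
    have "2 * of_real pi * (\<i> * of_real r) + of_real (real_of_int (2 * n) * pi) * \<i>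
        = 2 * of_real pi * (\<i> * of_real (of_int n + r))"
      by (simp add: algebra_simps)
    then show ?thesis by simp
  qed
  then show ?thesis unfolding exp_eq by simp
qed

text \<open>
  The roots of \<open>z^2 - z + 1\<close> are the primitive sixth roots of unity.
\<close>

lemma sixth_root_equation:
  "exp (2 * of_real pi * w) ^ 2 - exp (2 * of_real pi * w) + 1 = 0
    \<longleftrightarrow> (\<exists>n::int. w = \<i> * of_real (of_int n + 1/6) \<or> w = \<i> * of_real (of_int n - 1/6))"
proof -
  let ?e = "exp (2 * of_real pi * w)"
  let ?a = "of_real pi * \<i> / 3 :: complex"
  have "?e ^ 2 - ?e + 1 = (?e - exp ?a) * (?e - exp (- ?a))"
    unfolding exp_pi_third exp_minus_pi_third
    by (simp add: complex_eq_iff power2_eq_square algebra_simps) 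
  then have "?e ^ 2 - ?e + 1 = 0 \<longleftrightarrow> ?e = exp ?a \<or> ?e = exp (- ?a)" by simp
  moreover have "?e = exp ?a \<longleftrightarrow> (\<exists>n::int. w = \<i> * of_real (of_int n + 1/6))"
    using exp_2pi_eq_iff[of w "1/6"] by (simp add: mult_ac)
  moreover have "?e = exp (- ?a) \<longleftrightarrow> (\<exists>n::int. w = \<i> * of_real (of_int n - 1/6))"
    using exp_2pi_eq_iff[of w "- (1/6)"] by (simp add: mult_ac)
  ultimately show ?thesis by blast
qed

lemma denom41_eq_0_iff:
  "denom41 w = 0 \<longleftrightarrow> (\<exists>n::int. w = \<i> * of_real (of_int n + 1/6) \<or> w = \<i> * of_real (of_int n - 1/6))"
proof -
  have "denom41 w * exp (2 * of_real pi * w) = exp (2 * of_real pi * w) ^ 2 - exp (2 * of_real pi * w) + 1"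
    by (simp add: denom41_def exp_minus field_simps power2_eq_square)
  then have "denom41 w = 0 \<longleftrightarrow> exp (2 * of_real pi * w) ^ 2 - exp (2 * of_real pi * w) + 1 = 0"
    by (metis exp_not_eq_zero mult_eq_0_iff)
  then show ?thesis by (simp add: sixth_root_equation)
qed

lemma denom41_has_field_derivative:
  "(denom41 has_field_derivative 2 * of_real pi * (exp (2 * of_real pi * x) - exp (- (2 * of_real pi * x)))) (at x)"
  unfolding denom41_def by (auto intro!: derivative_eq_intros simp: algebra_simps)

lemma integrand41_neq_0: "integrand41 x \<noteq> 0"
  by (simp add: integrand41_def)

lemma integrand41_holomorphic: "integrand41 holomorphic_on phi_strip"
  unfolding integrand41_def by (intro holomorphic_intros log_Phi1_holomorphic)

lemma denom41_holomorphic: "denom41 holomorphic_on S"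
  unfolding denom41_def by (intro holomorphic_intros)

text \<open>
  The bound on the integrand grows like \<open>exp (2 \<pi> (1 - \<epsilon>) |Re x|)\<close> on the lower line, and
  division by the denominator, of size \<open>exp (2 \<pi> |Re x|)\<close>, leaves \<open>exp (- 2 \<pi> \<epsilon> |Re x|)\<close>.
  The condition \<open>\<epsilon> < 1/6\<close> puts \<open>- 5\<i>/6\<close> above the lower line and \<open>\<i>/6\<close> above the upper one.
\<close>

theorem integral41_residues:
  assumes "0 < \<epsilon>" "\<epsilon> < 1 / 6"
  shows "shifted_line_integrable \<epsilon> integrand41"
    and "shifted_line_integral \<epsilon> integrand41 = (integrand41 (- \<i> / 6) - integrand41 (- 5 * \<i> / 6)) / of_real (sqrt 3)"
proof -
  obtain C where C: "C > 0"
    "\<And>x. \<bar>Im x\<bar> \<le> 1 - \<epsilon> \<Longrightarrow> norm (integrand41 x) \<le> C * exp (- 2 * pi * \<bar>Re x\<bar> * Im x)"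
    using integrand41_bound[of "1 - \<epsilon>"] assms by auto
  show int: "shifted_line_integrable \<epsilon> integrand41"
  proof (rule shifted_line_integrable_exp_decay[where c = "2 * pi * \<epsilon>"])
    show "continuous_on {z. Im z = \<epsilon>} integrand41"
      by (rule continuous_on_subset[OF holomorphic_on_imp_continuous_on[OF integrand41_holomorphic]])
        (use assms in auto)
    show "norm (integrand41 z) \<le> C * exp (- (2 * pi * \<epsilon>) * \<bar>Re z\<bar>)" if "Im z = \<epsilon>" for z
      using C(2)[of z] that assms by (simp add: mult_ac)
  qed (use assms in auto)
  define K where "K = (\<lambda>x. integrand41 x / denom41 x)"
  define S where "S = {x. -1 < Im x \<and> Im x < 1 / 6}"
  define pts where "pts = {- \<i> / 6, - 5 * \<i> / 6}"
  have nz: "denom41 x \<noteq> 0" if x: "x \<in> S - pts" for x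
  proof
    assume "denom41 x = 0"
    then obtain n :: int where n: "x = \<i> * of_real (of_int n + 1/6) \<or> x = \<i> * of_real (of_int n - 1/6)"
      unfolding denom41_eq_0_iff by blast
    then show False
    proof
      assume n: "x = \<i> * of_real (of_int n + 1/6)"
      then have "-1 < real_of_int n + 1/6" "real_of_int n + 1/6 < 1/6" using x by (auto simp: S_def)
      then have "n = -1" by linarith
      then show False using n x by (simp add: pts_def complex_eq_iff)
    next
      assume n: "x = \<i> * of_real (of_int n - 1/6)"
      then have "-1 < real_of_int n - 1/6" "real_of_int n - 1/6 < 1/6" using x by (auto simp: S_def)
      then have "n = 0" by linarith
      then show False using n x by (simp add: pts_def complex_eq_iff)
    qed
  qed
  have K_holo: "K holomorphic_on S - pts"
    unfolding K_def
    by (intro holomorphic_intros denom41_holomorphic holomorphic_on_subset[OF integrand41_holomorphic] nz)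
      (auto simp: S_def)
  have K_decay: "norm (K z) \<le> 2 * C * exp (- (2 * pi * \<epsilon>) * \<bar>Re z\<bar>)"
    if z: "\<epsilon> - 1 \<le> Im z" "Im z \<le> \<epsilon>" "\<bar>Re z\<bar> \<ge> 1" for z
  proof -
    have "norm (K z) \<le> (C * exp (- 2 * pi * \<bar>Re z\<bar> * Im z)) / (exp (2 * pi * \<bar>Re z\<bar>) / 2)"
      unfolding K_def norm_divide
      using z assms C(1) by (intro frac_le C(2) denom41_bound) auto
    also have "\<dots> = 2 * C * exp (- (2 * pi * (1 + Im z)) * \<bar>Re z\<bar>)"
    proof -
      have "exp (- 2 * pi * \<bar>Re z\<bar> * Im z) / exp (2 * pi * \<bar>Re z\<bar>) = exp (- (2 * pi * (1 + Im z)) * \<bar>Re z\<bar>)"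
        unfolding exp_diff[symmetric] by (rule arg_cong[of _ _ exp]) (simp add: algebra_simps)
      moreover have "(C * a) / (b / 2) = 2 * C * (a / b)" for a b :: real by simp
      ultimately show ?thesis by (simp only:)
    qed
    also have "\<dots> \<le> 2 * C * exp (- (2 * pi * \<epsilon>) * \<bar>Re z\<bar>)"
      using z C(1) by (intro mult_left_mono) (auto intro!: mult_right_mono)
    finally show ?thesis .
  qed
  have K_int: "shifted_line_integrable a K" if "a = \<epsilon> \<or> a = \<epsilon> - 1" for a
  proof (rule shifted_line_integrable_exp_decay[where c = "2 * pi * \<epsilon>" and R = 1])
    show "continuous_on {z. Im z = a} K"
      by (rule continuous_on_subset[OF holomorphic_on_imp_continuous_on[OF K_holo]])
        (use assms that in \<open>auto simp: S_def pts_def\<close>)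
    show "norm (K z) \<le> 2 * C * exp (- (2 * pi * \<epsilon>) * \<bar>Re z\<bar>)" if "Im z = a" "1 \<le> \<bar>Re z\<bar>" for z
      using K_decay[of z] that \<open>a = \<epsilon> \<or> a = \<epsilon> - 1\<close> by auto
  qed (use assms in auto)
  have diff: "integrand41 (of_real t + \<i> * of_real \<epsilon>)
      = K (of_real t + \<i> * of_real \<epsilon>) - K (of_real t + \<i> * of_real (\<epsilon> - 1))" for t
  proof -
    define x where "x = of_real t + \<i> * of_real \<epsilon>"
    have x: "0 < Im x" "Im x < 1" using assms by (simp_all add: x_def)
    have "x \<in> S - pts" using assms by (auto simp: S_def pts_def x_def complex_eq_iff)
    then have "denom41 x \<noteq> 0" by (rule nz)
    then have "integrand41 x = K x - K (x - \<i>)"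
      unfolding K_def integrand41_shift[OF x] denom41_shift by (simp add: field_simps)
    moreover have "of_real t + \<i> * of_real (\<epsilon> - 1) = x - \<i>" by (simp add: x_def algebra_simps)
    ultimately show ?thesis unfolding x_def[symmetric] by (simp only:)
  qed
  have "shifted_line_integral \<epsilon> integrand41 = shifted_line_integral \<epsilon> K - shifted_line_integral (\<epsilon> - 1) K"
    using K_int[of \<epsilon>] K_int[of "\<epsilon> - 1"]
    unfolding shifted_line_integral_def shifted_line_integrable_def diff
    by (intro Bochner_Integration.integral_diff) simp_all
  also have "\<dots> = - (2 * of_real pi * \<i> * (\<Sum>p\<in>pts. residue K p))"
  proof -
    have "shifted_line_integral (\<epsilon> - 1) K - shifted_line_integral \<epsilon> K = 2 * of_real pi * \<i> * (\<Sum>p\<in>pts. residue K p)"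
    proof (rule strip_residue_theorem[where S = S and c = "2 * pi * \<epsilon>" and r = 1 and K = "2 * C"])
      show "open S" "connected S" unfolding S_def by (rule open_Im_strip connected_Im_strip)+
    qed (use assms K_holo K_decay in \<open>auto simp: S_def pts_def\<close>)
    then show ?thesis by (simp add: algebra_simps)
  qed
  also have "(\<Sum>p\<in>pts. residue K p) = residue K (- \<i> / 6) + residue K (- 5 * \<i> / 6)"
    by (simp add: pts_def complex_eq_iff)
  also have "residue K (- \<i> / 6) = integrand41 (- \<i> / 6) / (2 * of_real pi * (- (\<i> * of_real (sqrt 3))))"
    unfolding K_def
  proof (rule residue_simple_pole_deriv[where s = phi_strip])
    have "2 * of_real pi * (- \<i> / 6) = - (of_real pi * \<i> / 3)" by simp
    then have "exp (2 * of_real pi * (- \<i> / 6)) - exp (- (2 * of_real pi * (- \<i> / 6))) = - (\<i> * of_real (sqrt 3))"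
      by (simp only: exp_pi_third exp_minus_pi_third minus_minus) (simp add: complex_eq_iff)
    then show "(denom41 has_field_derivative 2 * of_real pi * (- (\<i> * of_real (sqrt 3)))) (at (- \<i> / 6))"
      using denom41_has_field_derivative[of "- \<i> / 6"] by (simp only:)
    show "denom41 (- \<i> / 6) = 0"
      unfolding denom41_eq_0_iff by (rule exI[of _ 0]) (simp add: complex_eq_iff)
  qed (auto simp: integrand41_neq_0 intro!: integrand41_holomorphic denom41_holomorphic open_phi_strip connected_phi_strip)
  also have "residue K (- 5 * \<i> / 6) = integrand41 (- 5 * \<i> / 6) / (2 * of_real pi * (\<i> * of_real (sqrt 3)))"
    unfolding K_def
  proof (rule residue_simple_pole_deriv[where s = phi_strip])
    have "exp (2 * of_real pi * (- 5 * \<i> / 6)) = exp (of_real pi * \<i> / 3)"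
      "exp (- (2 * of_real pi * (- 5 * \<i> / 6))) = exp (- (of_real pi * \<i> / 3))"
      unfolding exp_eq by (rule exI[of _ "-1"], simp add: field_simps, rule exI[of _ 1], simp add: field_simps)
    then have "exp (2 * of_real pi * (- 5 * \<i> / 6)) - exp (- (2 * of_real pi * (- 5 * \<i> / 6))) = \<i> * of_real (sqrt 3)"
      by (simp only: exp_pi_third exp_minus_pi_third) (simp add: complex_eq_iff)
    then show "(denom41 has_field_derivative 2 * of_real pi * (\<i> * of_real (sqrt 3))) (at (- 5 * \<i> / 6))"
      using denom41_has_field_derivative[of "- 5 * \<i> / 6"] by (simp only:)
    show "denom41 (- 5 * \<i> / 6) = 0"
      unfolding denom41_eq_0_iff by (rule exI[of _ "-1"]) (simp add: complex_eq_iff)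
  qed (auto simp: integrand41_neq_0 intro!: integrand41_holomorphic denom41_holomorphic open_phi_strip connected_phi_strip)
  also have "- (2 * of_real pi * \<i> * (integrand41 (- \<i> / 6) / (2 * of_real pi * (- (\<i> * of_real (sqrt 3))))
      + integrand41 (- 5 * \<i> / 6) / (2 * of_real pi * (\<i> * of_real (sqrt 3)))))
      = (integrand41 (- \<i> / 6) - integrand41 (- 5 * \<i> / 6)) / of_real (sqrt 3)"
    by (simp add: field_simps)
  finally show "shifted_line_integral \<epsilon> integrand41
      = (integrand41 (- \<i> / 6) - integrand41 (- 5 * \<i> / 6)) / of_real (sqrt 3)" .
qed

section \<open>The dilogarithm at a primitive sixth root of unity\<close>

lemma Li2_cnj:
  assumes "norm z \<le> 1" shows "Li2 (cnj z) = cnj (Li2 z)"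
proof -
  have "(\<lambda>n. cnj (1 / of_nat n ^ 2 * z ^ n)) sums cnj (\<Sum>n. 1 / of_nat n ^ 2 * z ^ n)"
    unfolding sums_cnj by (rule summable_sums[OF summable_Li2[OF assms]])
  then have "(\<Sum>n. 1 / of_nat n ^ 2 * cnj z ^ n) = cnj (\<Sum>n. 1 / of_nat n ^ 2 * z ^ n)"
    by (simp add: sums_iff)
  then show ?thesis using assms by (simp add: Li2_eq_power_series)
qed

lemma one_minus_exp_pi_third: "1 - exp (of_real pi * \<i> / 3) = exp (- (of_real pi * \<i> / 3))"
  unfolding exp_pi_third exp_minus_pi_third by (simp add: complex_eq_iff)

lemma one_minus_exp_minus_pi_third: "1 - exp (- (of_real pi * \<i> / 3)) = exp (of_real pi * \<i> / 3)"
  unfolding exp_pi_third exp_minus_pi_third by (simp add: complex_eq_iff)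

lemma Ln_exp_pi_third:
  "Ln (exp (of_real pi * \<i> / 3)) = of_real pi * \<i> / 3"
  "Ln (exp (- (of_real pi * \<i> / 3))) = - (of_real pi * \<i> / 3)"
proof -
  have "- pi < pi / 3" "pi / 3 \<le> pi" "- pi < - (pi / 3)" "- (pi / 3) \<le> pi"
    using pi_gt_zero by linarith+
  then show "Ln (exp (of_real pi * \<i> / 3)) = of_real pi * \<i> / 3"
    "Ln (exp (- (of_real pi * \<i> / 3))) = - (of_real pi * \<i> / 3)"
    by (intro Ln_exp; simp)+
qed

lemma log_Phi1_sixth:
  "log_Phi1 (\<i> / 6) = \<i> / (2 * of_real pi) * (Li2 (exp (of_real pi * \<i> / 3)) + of_real pi ^ 2 / 9)"
  "log_Phi1 (- \<i> / 6) = \<i> / (2 * of_real pi) * (Li2 (exp (- (of_real pi * \<i> / 3))) + of_real pi ^ 2 / 9)"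
proof -
  have e: "exp (2 * pi * \<i> * of_real (1/6)) = exp (of_real pi * \<i> / 3)"
    "exp (2 * pi * \<i> * of_real (- (1/6))) = exp (- (of_real pi * \<i> / 3))"
    by (rule arg_cong[of _ _ exp], simp)+
  show "log_Phi1 (\<i> / 6) = \<i> / (2 * of_real pi) * (Li2 (exp (of_real pi * \<i> / 3)) + of_real pi ^ 2 / 9)"
    using log_Phi1_imaginary_axis[of "1/6"]
    unfolding e one_minus_exp_pi_third Ln_exp_pi_third by (simp add: power2_eq_square algebra_simps)
  show "log_Phi1 (- \<i> / 6) = \<i> / (2 * of_real pi) * (Li2 (exp (- (of_real pi * \<i> / 3))) + of_real pi ^ 2 / 9)"
    using log_Phi1_imaginary_axis[of "- (1/6)"]
    unfolding e one_minus_exp_minus_pi_third Ln_exp_pi_third by (simp add: power2_eq_square algebra_simps)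
qed

lemma exp_minus_pi_third_cnj: "exp (- (of_real pi * \<i> / 3)) = cnj (exp (of_real pi * \<i> / 3))"
  unfolding exp_pi_third exp_minus_pi_third by (simp add: complex_eq_iff)

text \<open>
  Inversion at \<open>\<i>/6\<close>, with the dilogarithm formula at \<open>\<i>/6\<close> and \<open>- \<i>/6\<close>, determines the sum of \<open>Li2\<close> at two
  conjugate points, that is, twice the real part.
\<close>

lemma Li2_sixth_root:
  assumes "V = 2 * Im (Li2 (exp (of_real pi * \<i> / 3)))"
  shows "Li2 (exp (of_real pi * \<i> / 3)) = of_real (pi ^ 2 / 36) + \<i> * of_real (V / 2)"
    and "Li2 (exp (- (of_real pi * \<i> / 3))) = of_real (pi ^ 2 / 36) - \<i> * of_real (V / 2)"
proof -
  let ?z = "exp (of_real pi * \<i> / 3 :: complex)"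
  have cnj: "Li2 (exp (- (of_real pi * \<i> / 3))) = cnj (Li2 ?z)"
    unfolding exp_minus_pi_third_cnj by (rule Li2_cnj) simp
  have "log_Phi1 (\<i> / 6) + log_Phi1 (- (\<i> / 6)) = pi * \<i> * (\<i> / 6) ^ 2 + 2 * log_Phi1 0"
    by (rule log_Phi1_inversion) simp
  then have "\<i> / (2 * of_real pi) * (Li2 ?z + of_real pi ^ 2 / 9)
      + \<i> / (2 * of_real pi) * (cnj (Li2 ?z) + of_real pi ^ 2 / 9) = 5 * pi * \<i> / 36"
    using log_Phi1_sixth unfolding cnj log_Phi1_0 by (simp add: power2_eq_square)
  then have "\<i> / (2 * of_real pi) * (of_real (2 * Re (Li2 ?z)) + 2 * of_real pi ^ 2 / 9) = 5 * pi * \<i> / 36"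
    unfolding complex_add_cnj[symmetric] by (simp add: algebra_simps)
  then have "(2 * Re (Li2 ?z) + 2 * pi ^ 2 / 9) / (2 * pi) = 5 * pi / 36"
    by (simp add: complex_eq_iff power2_eq_square)
  then have "Re (Li2 ?z) = pi ^ 2 / 36"
    by (simp add: field_simps power2_eq_square)
  then show "Li2 ?z = of_real (pi ^ 2 / 36) + \<i> * of_real (V / 2)"
    using assms by (simp add: complex_eq_iff)
  then show "Li2 (exp (- (of_real pi * \<i> / 3))) = of_real (pi ^ 2 / 36) - \<i> * of_real (V / 2)"
    unfolding cnj by simp
qed

text \<open>
  At \<open>- \<i>/6\<close> the dilogarithm formula applies directly.  The other pole is \<open>\<i>/6 - \<i>\<close>, and since the
  denominator vanishes there the quasi-periodicity factor is \<open>1\<close>, so the value is that at \<open>\<i>/6\<close>.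
\<close>

theorem integrand41_values:
  assumes "V = 2 * Im (Li2 (exp (of_real pi * \<i> / 3)))"
  shows "integrand41 (- \<i> / 6) = exp (of_real pi * \<i> / 6) * of_real (exp (V / (2 * pi)))"
    and "integrand41 (- 5 * \<i> / 6) = exp (of_real pi * \<i> / 6) * of_real (exp (- V / (2 * pi)))"
proof -
  note Li2 = Li2_sixth_root[OF assms]
  have "2 * log_Phi1 (- \<i> / 6) - of_real pi * \<i> * (- \<i> / 6) ^ 2 = of_real pi * \<i> / 6 + of_real (V / (2 * pi))"
    unfolding log_Phi1_sixth Li2 by (simp add: complex_eq_iff power2_eq_square field_simps)
  then show "integrand41 (- \<i> / 6) = exp (of_real pi * \<i> / 6) * of_real (exp (V / (2 * pi)))"
    unfolding integrand41_def by (simp only: exp_add exp_of_real)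
  have "2 * log_Phi1 (\<i> / 6) - of_real pi * \<i> * (\<i> / 6) ^ 2 = of_real pi * \<i> / 6 + of_real (- V / (2 * pi))"
    unfolding log_Phi1_sixth Li2 by (simp add: complex_eq_iff power2_eq_square field_simps)
  then have F: "integrand41 (\<i> / 6) = exp (of_real pi * \<i> / 6) * of_real (exp (- V / (2 * pi)))"
    unfolding integrand41_def by (simp only: exp_add exp_of_real)
  have "denom41 (\<i> / 6) = 0"
    unfolding denom41_eq_0_iff by (rule exI[of _ 0]) (simp add: complex_eq_iff)
  then have "integrand41 (\<i> / 6 - \<i>) = integrand41 (\<i> / 6)"
    using integrand41_shift[of "\<i> / 6"] by simp
  moreover have "\<i> / 6 - \<i> = - 5 * \<i> / 6" by (simp add: complex_eq_iff)
  ultimately show "integrand41 (- 5 * \<i> / 6) = exp (of_real pi * \<i> / 6) * of_real (exp (- V / (2 * pi)))"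
    using F by simp
qed

theorem state_integral_41:
  fixes V :: real
  assumes V: "V = 2 * Im (Li2 (exp (of_real pi * \<i> / 3)))" and \<epsilon>: "0 < \<epsilon>" "\<epsilon> < 1 / 6"
  shows "shifted_line_integrable \<epsilon> (\<lambda>x. Phi1 x ^ 2 * exp (- of_real pi * \<i> * x ^ 2))"
    and "shifted_line_integral \<epsilon> (\<lambda>x. Phi1 x ^ 2 * exp (- of_real pi * \<i> * x ^ 2))
      = exp (of_real pi * \<i> / 6) / of_real (sqrt 3) * of_real (exp (V / (2 * pi)) - exp (- V / (2 * pi)))"
proof -
  have eq: "Phi1 (of_real t + \<i> * of_real \<epsilon>) ^ 2 * exp (- of_real pi * \<i> * (of_real t + \<i> * of_real \<epsilon>) ^ 2)
      = integrand41 (of_real t + \<i> * of_real \<epsilon>)" for t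
    by (rule integrand41_eq) (use \<epsilon> in simp)
  show "shifted_line_integrable \<epsilon> (\<lambda>x. Phi1 x ^ 2 * exp (- of_real pi * \<i> * x ^ 2))"
    using integral41_residues(1)[OF \<epsilon>] unfolding shifted_line_integrable_def eq .
  have "shifted_line_integral \<epsilon> (\<lambda>x. Phi1 x ^ 2 * exp (- of_real pi * \<i> * x ^ 2)) = shifted_line_integral \<epsilon> integrand41"
    unfolding shifted_line_integral_def eq ..
  also have "\<dots> = exp (of_real pi * \<i> / 6) / of_real (sqrt 3) * of_real (exp (V / (2 * pi)) - exp (- V / (2 * pi)))"
    unfolding integral41_residues(2)[OF \<epsilon>] integrand41_values[OF V] of_real_diff by (simp add: field_simps)
  finally show "shifted_line_integral \<epsilon> (\<lambda>x. Phi1 x ^ 2 * exp (- of_real pi * \<i> * x ^ 2))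
      = exp (of_real pi * \<i> / 6) / of_real (sqrt 3) * of_real (exp (V / (2 * pi)) - exp (- V / (2 * pi)))" .
qed

section \<open>Decimals of the volume\<close>

text \<open>
  First terms of the asymptotic expansion, in \<open>w = y - 1/2\<close>, of the trigamma function
  \<open>\<Sum>k. 1 / (y + k)^2\<close>.  The half-integer shift makes it an expansion in odd powers of \<open>1 / w\<close>; two
  terms give a lower bound and three an upper bound.
\<close>

definition trigamma_lower :: "real \<Rightarrow> real"
  where "trigamma_lower w = 1 / w - 1 / (12 * w ^ 3)"

definition trigamma_upper :: "real \<Rightarrow> real"
  where "trigamma_upper w = trigamma_lower w + 7 / (240 * w ^ 5)"

text \<open>
  In terms of \<open>m = w (w + 1)\<close> all quantities are rational functions of one variable, and the two
  differences have numerators with positive coefficients.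
\<close>

lemma trigamma_telescope:
  fixes w :: real
  assumes "w > 0"
  shows "trigamma_lower w - trigamma_lower (w + 1) \<le> 1 / (w + 1/2) ^ 2"
    and "1 / (w + 1/2) ^ 2 \<le> trigamma_upper w - trigamma_upper (w + 1)"
proof -
  define m where "m = w * (w + 1)"
  have m: "m > 0" using assms by (simp add: m_def)
  have w: "w \<noteq> 0" "w + 1 \<noteq> 0" using assms by auto
  have d1: "1 / w - 1 / (w + 1) = 1 / m"
    using w by (simp add: m_def field_simps)
  have d3: "1 / w ^ 3 - 1 / (w + 1) ^ 3 = (3 * m + 1) / m ^ 3"
  proof -
    have "1 / w ^ 3 - 1 / (w + 1) ^ 3 = ((w + 1) ^ 3 - w ^ 3) / (w * (w + 1)) ^ 3"
      using w by (simp add: diff_frac_eq power_mult_distrib)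
    also have "(w + 1) ^ 3 - w ^ 3 = 3 * m + 1" unfolding m_def by algebra
    finally show ?thesis by (simp add: m_def)
  qed
  have d5: "1 / w ^ 5 - 1 / (w + 1) ^ 5 = (5 * m ^ 2 + 5 * m + 1) / m ^ 5"
  proof -
    have "1 / w ^ 5 - 1 / (w + 1) ^ 5 = ((w + 1) ^ 5 - w ^ 5) / (w * (w + 1)) ^ 5"
      using w by (simp add: diff_frac_eq power_mult_distrib)
    also have "(w + 1) ^ 5 - w ^ 5 = 5 * m ^ 2 + 5 * m + 1" unfolding m_def by algebra
    finally show ?thesis by (simp add: m_def)
  qed
  have mid: "1 / (w + 1/2) ^ 2 = 4 / (4 * m + 1)"
  proof -
    have "4 * m + 1 = 4 * (w + 1/2) ^ 2" by (simp add: m_def power2_eq_square algebra_simps)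
    then show ?thesis by simp
  qed
  have lower: "trigamma_lower w - trigamma_lower (w + 1) = 1 / m - (3 * m + 1) / (12 * m ^ 3)"
  proof -
    have "trigamma_lower w - trigamma_lower (w + 1) = (1 / w - 1 / (w + 1)) - (1 / w ^ 3 - 1 / (w + 1) ^ 3) / 12"
      by (simp add: trigamma_lower_def diff_divide_distrib)
    then show ?thesis unfolding d1 d3 by simp
  qed
  have "4 / (4 * m + 1) - (1 / m - (3 * m + 1) / (12 * m ^ 3)) = (7 * m + 1) / (12 * m ^ 3 * (4 * m + 1))"
    using m by (simp add: divide_simps) (simp add: algebra_simps power2_eq_square power3_eq_cube)
  moreover have "(7 * m + 1) / (12 * m ^ 3 * (4 * m + 1)) \<ge> 0" using m by simp
  ultimately show "trigamma_lower w - trigamma_lower (w + 1) \<le> 1 / (w + 1/2) ^ 2"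
    unfolding lower mid by linarith
  have upper: "trigamma_upper w - trigamma_upper (w + 1)
      = 1 / m - (3 * m + 1) / (12 * m ^ 3) + 7 * (5 * m ^ 2 + 5 * m + 1) / (240 * m ^ 5)"
  proof -
    have "7 / (240 * w ^ 5) - 7 / (240 * (w + 1) ^ 5) = 7 / 240 * ((5 * m ^ 2 + 5 * m + 1) / m ^ 5)"
      unfolding d5[symmetric] by (simp add: right_diff_distrib)
    then show ?thesis using lower by (simp add: trigamma_upper_def)
  qed
  have "1 / m - (3 * m + 1) / (12 * m ^ 3) + 7 * (5 * m ^ 2 + 5 * m + 1) / (240 * m ^ 5) - 4 / (4 * m + 1)
      = (155 * m ^ 2 + 63 * m + 7) / (240 * m ^ 5 * (4 * m + 1))"
    using m by (simp add: divide_simps) (simp add: algebra_simps eval_nat_numeral)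
  moreover have "(155 * m ^ 2 + 63 * m + 7) / (240 * m ^ 5 * (4 * m + 1)) \<ge> 0" using m by simp
  ultimately show "1 / (w + 1/2) ^ 2 \<le> trigamma_upper w - trigamma_upper (w + 1)"
    unfolding upper mid by linarith
qed

lemma partial_sum_telescope_bounds:
  fixes b L U :: "nat \<Rightarrow> real"
  assumes "b sums s"
    and lower: "\<And>n. n \<ge> N \<Longrightarrow> L n - L (Suc n) \<le> b n" and "L \<longlonglongrightarrow> 0"
    and upper: "\<And>n. n \<ge> N \<Longrightarrow> b n \<le> U n - U (Suc n)" and "U \<longlonglongrightarrow> 0"
  shows "(\<Sum>n<N. b n) + L N \<le> s" and "s \<le> (\<Sum>n<N. b n) + U N"
proof -
  have tail: "(\<lambda>n. b (n + N)) sums (s - (\<Sum>n<N. b n))"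
    by (rule sums_split_initial_segment[OF \<open>b sums s\<close>])
  have tel: "(\<lambda>n. G (n + N) - G (Suc (n + N))) sums (G N - 0)" if "G \<longlonglongrightarrow> 0" for G :: "nat \<Rightarrow> real"
    using telescope_sums'[OF LIMSEQ_ignore_initial_segment[OF that, of N]] by simp
  have "L N - 0 \<le> s - (\<Sum>n<N. b n)"
    by (rule sums_le[OF _ tel[OF \<open>L \<longlonglongrightarrow> 0\<close>] tail]) (use lower in auto)
  then show "(\<Sum>n<N. b n) + L N \<le> s" by simp
  have "s - (\<Sum>n<N. b n) \<le> U N - 0"
    by (rule sums_le[OF _ tail tel[OF \<open>U \<longlonglongrightarrow> 0\<close>]]) (use upper in auto)
  then show "s \<le> (\<Sum>n<N. b n) + U N" by simp
qed

text \<open>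
  \<open>sin (k \<pi> / 3)\<close> is \<open>sqrt 3 / 2\<close> times \<open>1, 1, 0, - 1, - 1, 0\<close>, so six consecutive terms of
  \<open>Im Li2\<close> combine into one rational term.
\<close>

definition vol_term :: "nat \<Rightarrow> real"
  where "vol_term n = 1 / (6 * real n + 1) ^ 2 + 1 / (6 * real n + 2) ^ 2 - 1 / (6 * real n + 4) ^ 2 - 1 / (6 * real n + 5) ^ 2"

lemma Im_exp_pi_third_power:
  fixes n :: nat
  defines "z \<equiv> exp (of_real pi * \<i> / 3)"
  shows "Im (z ^ (6 * n + 1)) = sqrt 3 / 2" "Im (z ^ (6 * n + 2)) = sqrt 3 / 2" "Im (z ^ (6 * n + 3)) = 0"
    "Im (z ^ (6 * n + 4)) = - sqrt 3 / 2" "Im (z ^ (6 * n + 5)) = - sqrt 3 / 2" "Im (z ^ (6 * n + 6)) = 0"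
proof -
  have z: "z = Complex (1/2) (sqrt 3 / 2)" by (simp add: z_def exp_pi_third)
  have z2: "z ^ 2 = Complex (-1/2) (sqrt 3 / 2)"
    by (simp add: z complex_eq_iff power2_eq_square)
  have z3: "z ^ 3 = -1"
  proof -
    have "z ^ 3 = z * z ^ 2" by (simp add: power2_eq_square power3_eq_cube)
    then show ?thesis unfolding z2 unfolding z by (simp add: complex_eq_iff)
  qed
  have z6: "z ^ (6 * n) = 1"
  proof -
    have "z ^ (6 * n) = ((z ^ 3) ^ 2) ^ n" by (simp flip: power_mult)
    then show ?thesis by (simp add: z3)
  qed
  have z4: "z ^ 4 = - z" and z5: "z ^ 5 = - (z ^ 2)" and z66: "z ^ 6 = 1"
    using power_add[of z 3 1] power_add[of z 3 2] power_add[of z 3 3] by (simp_all add: z3)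
  show "Im (z ^ (6 * n + 1)) = sqrt 3 / 2" "Im (z ^ (6 * n + 2)) = sqrt 3 / 2" "Im (z ^ (6 * n + 3)) = 0"
    "Im (z ^ (6 * n + 4)) = - sqrt 3 / 2" "Im (z ^ (6 * n + 5)) = - sqrt 3 / 2" "Im (z ^ (6 * n + 6)) = 0"
    unfolding power_add z6 z3 z4 z5 z66 z2 by (simp_all add: z)
qed

lemma vol_term_sums:
  assumes V: "V = 2 * Im (Li2 (exp (of_real pi * \<i> / 3)))"
  shows "vol_term sums (V / sqrt 3)"
proof -
  define z where "z = exp (of_real pi * \<i> / 3)"
  define c where "c = (\<lambda>k. Im (z ^ Suc k / of_nat (Suc k) ^ 2))"
  have norm_z: "norm z \<le> 1" by (simp add: z_def)
  have "(\<lambda>k. 1 / of_nat (Suc k) ^ 2 * z ^ Suc k) sums Li2 z"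
    using summable_sums[OF summable_Li2[OF norm_z]] Li2_eq_power_series[OF norm_z]
    by (subst sums_Suc_iff) simp
  then have "c sums Im (Li2 z)"
    unfolding c_def by (intro sums_Im) (simp add: mult.commute)
  then have group: "(\<lambda>n. sum c {n * 6..<n * 6 + 6}) sums (V / 2)"
    using sums_group[of c _ 6] V by (simp add: z_def)
  have c: "c k = Im (z ^ m) / real m ^ 2" if "m = Suc k" for k m
  proof -
    have "z ^ Suc k / of_nat (Suc k) ^ 2 = z ^ m / of_real (real m ^ 2)" by (simp add: that)
    then show ?thesis unfolding c_def by (simp only: Im_divide_of_real)
  qed
  have "sum c {n * 6..<n * 6 + 6} = sqrt 3 / 2 * vol_term n" for n
  proof -
    note Im = Im_exp_pi_third_power[of n, folded z_def]
    have "{n * 6..<n * 6 + 6} = {6 * n, 6 * n + 1, 6 * n + 2, 6 * n + 3, 6 * n + 4, 6 * n + 5}" by auto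
    then have "sum c {n * 6..<n * 6 + 6}
        = c (6 * n) + c (6 * n + 1) + c (6 * n + 2) + c (6 * n + 3) + c (6 * n + 4) + c (6 * n + 5)"
      by simp
    also have "\<dots> = sqrt 3 / 2 / (6 * real n + 1) ^ 2 + sqrt 3 / 2 / (6 * real n + 2) ^ 2
        + (- sqrt 3 / 2) / (6 * real n + 4) ^ 2 + (- sqrt 3 / 2) / (6 * real n + 5) ^ 2"
      using c[of "6 * n + 1" "6 * n"] c[of "6 * n + 2" "6 * n + 1"] c[of "6 * n + 3" "6 * n + 2"]
        c[of "6 * n + 4" "6 * n + 3"] c[of "6 * n + 5" "6 * n + 4"] c[of "6 * n + 6" "6 * n + 5"]
      unfolding Im by (simp add: add.commute)
    also have "\<dots> = sqrt 3 / 2 * vol_term n"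
      by (simp add: vol_term_def algebra_simps)
    finally show ?thesis .
  qed
  with group have "(\<lambda>n. sqrt 3 / 2 * vol_term n) sums (V / 2)" by simp
  then have "(\<lambda>n. 2 / sqrt 3 * (sqrt 3 / 2 * vol_term n)) sums (2 / sqrt 3 * (V / 2))"
    by (rule sums_mult)
  then show ?thesis by simp
qed

text \<open>
  The residue classes \<open>6 n + 1\<close>, \<open>6 n + 2\<close>, \<open>6 n + 4\<close>, \<open>6 n + 5\<close> are \<open>6 y\<close> with
  \<open>y = n + 1/6, n + 1/3, n + 2/3, n + 5/6\<close>; subtracting \<open>1/2\<close> gives the arguments below.
\<close>

definition vol_tail :: "(real \<Rightarrow> real) \<Rightarrow> (real \<Rightarrow> real) \<Rightarrow> nat \<Rightarrow> real"
  where "vol_tail f g n = (f (real n - 1/3) + f (real n - 1/6) - g (real n + 1/6) - g (real n + 1/3)) / 36"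

lemma vol_tail_tendsto_0:
  "vol_tail trigamma_lower trigamma_upper \<longlonglongrightarrow> 0" "vol_tail trigamma_upper trigamma_lower \<longlonglongrightarrow> 0"
  unfolding vol_tail_def trigamma_upper_def trigamma_lower_def by real_asymp+

lemma vol_term_bounds:
  assumes "n \<ge> 1"
  shows "vol_tail trigamma_lower trigamma_upper n - vol_tail trigamma_lower trigamma_upper (Suc n) \<le> vol_term n"
    and "vol_term n \<le> vol_tail trigamma_upper trigamma_lower n - vol_tail trigamma_upper trigamma_lower (Suc n)"
proof -
  have n: "real n \<ge> 1" using assms by simp
  have shift: "real (Suc n) + x = (real n + x) + 1" "real (Suc n) - x = (real n - x) + 1" for x
    by simp_all
  have sq: "1 / (6 * real n + j) ^ 2 = (1 / (real n + j / 6) ^ 2) / 36" for j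
  proof -
    have "(6 * real n + j) ^ 2 = 36 * (real n + j / 6) ^ 2" by (simp add: power2_eq_square algebra_simps)
    then show ?thesis by simp
  qed
  have half: "real n - 1/3 + 1/2 = real n + 1/6" "real n - 1/6 + 1/2 = real n + 2/6"
    "real n + 1/6 + 1/2 = real n + 4/6" "real n + 1/3 + 1/2 = real n + 5/6" by simp_all
  have vt: "vol_term n = (1 / (real n - 1/3 + 1/2) ^ 2 + 1 / (real n - 1/6 + 1/2) ^ 2
      - 1 / (real n + 1/6 + 1/2) ^ 2 - 1 / (real n + 1/3 + 1/2) ^ 2) / 36"
    unfolding vol_term_def sq half by simp
  have pos: "real n - 1/3 > 0" "real n - 1/6 > 0" "real n + 1/6 > 0" "real n + 1/3 > 0" using n by linarith+
  note t = pos[THEN trigamma_telescope(1)] pos[THEN trigamma_telescope(2)]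
  show "vol_tail trigamma_lower trigamma_upper n - vol_tail trigamma_lower trigamma_upper (Suc n) \<le> vol_term n"
    unfolding vol_tail_def vt shift using t by argo
  show "vol_term n \<le> vol_tail trigamma_upper trigamma_lower n - vol_tail trigamma_upper trigamma_lower (Suc n)"
    unfolding vol_tail_def vt shift using t by argo
qed

text \<open>
  After \<open>13\<close> terms the enclosure of \<open>V / sqrt 3\<close> has width about \<open>9 / 10^9\<close> and lies between
  \<open>1.171953613\<close> and \<open>1.171953624\<close>, which is enough for seven decimals of \<open>V\<close>.
\<close>

theorem volume_bounds:
  fixes V :: real
  assumes V: "V = 2 * Im (Li2 (exp (of_real pi * \<i> / 3)))"
  shows "2.0298832 \<le> V" "V < 2.0298833"
proof -
  have sqrt3: "1.7320508075 < sqrt 3" "sqrt 3 < 1.7320508076"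
    by (rule real_less_rsqrt, simp add: power2_eq_square, rule real_less_lsqrt) (simp_all add: power2_eq_square)
  note bounds = partial_sum_telescope_bounds[OF vol_term_sums[OF V], where N = 13,
      OF vol_term_bounds(1) vol_tail_tendsto_0(1) vol_term_bounds(2) vol_tail_tendsto_0(2)]
  have "1.171953613 < (\<Sum>n<13. vol_term n) + vol_tail trigamma_lower trigamma_upper 13"
    by (simp add: vol_term_def vol_tail_def trigamma_lower_def trigamma_upper_def eval_nat_numeral)
  with bounds(1) have "1.171953613 < V / sqrt 3" by linarith
  then have "1.171953613 * sqrt 3 < V" by (simp add: field_simps)
  have "2.0298832 \<le> 1.171953613 * (1.7320508075 :: real)" by simp
  also have "\<dots> \<le> 1.171953613 * sqrt 3" using sqrt3 by (intro mult_left_mono) auto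
  also have "\<dots> < V" by fact
  finally show "2.0298832 \<le> V" by simp
  have "(\<Sum>n<13. vol_term n) + vol_tail trigamma_upper trigamma_lower 13 < 1.171953624"
    by (simp add: vol_term_def vol_tail_def trigamma_lower_def trigamma_upper_def eval_nat_numeral)
  with bounds(2) have "V / sqrt 3 < 1.171953624" by linarith
  then have "V < 1.171953624 * sqrt 3" by (simp add: field_simps)
  also have "1.171953624 * sqrt 3 \<le> 1.171953624 * 1.7320508076" using sqrt3 by (intro mult_left_mono) auto
  also have "\<dots> < 2.0298833" by simp
  finally show "V < 2.0298833" .
qed

section \<open>The critical points and their contributions\<close>

lemma gAB_1_2: "gAB 1 2 z = - z * (1 - z) powi (- 2)"
  by (simp add: gAB_def)

lemma gAB_1_2_eq_1_iff: "gAB 1 2 z = 1 \<longleftrightarrow> z ^ 2 - z + 1 = 0"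
proof (cases "z = 1")
  case False
  then have "gAB 1 2 z = - z / (1 - z) ^ 2"
    by (simp add: gAB_1_2 power_int_minus divide_inverse)
  then have "gAB 1 2 z = 1 \<longleftrightarrow> - z = (1 - z) ^ 2"
    using False nonzero_divide_eq_eq[of "(1 - z) ^ 2" "- z" 1] by simp
  also have "\<dots> \<longleftrightarrow> (1 - z) ^ 2 + z = 0"
    by (metis eq_neg_iff_add_eq_0)
  also have "(1 - z) ^ 2 + z = z ^ 2 - z + 1" by (simp add: power2_eq_square algebra_simps)
  finally show ?thesis .
qed (simp add: gAB_1_2)

lemma gAB_1_2_solutions:
  assumes "- (1 / 6) < lam" "lam < 0"
  shows "{w. gAB 1 2 (exp (2 * of_real pi * w)) = 1 \<and> 0 < Im w - lam \<and> Im w - lam < 1} = {\<i> / 6, 5 * \<i> / 6}"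
proof (intro equalityI subsetI)
  fix w assume "w \<in> {w. gAB 1 2 (exp (2 * of_real pi * w)) = 1 \<and> 0 < Im w - lam \<and> Im w - lam < 1}"
  then have w: "lam < Im w" "Im w < 1 + lam" and "exp (2 * of_real pi * w) ^ 2 - exp (2 * of_real pi * w) + 1 = 0"
    by (auto simp: gAB_1_2_eq_1_iff)
  then obtain n :: int where "w = \<i> * of_real (of_int n + 1/6) \<or> w = \<i> * of_real (of_int n - 1/6)"
    unfolding sixth_root_equation by blast
  then show "w \<in> {\<i> / 6, 5 * \<i> / 6}"
  proof
    assume n: "w = \<i> * of_real (of_int n + 1/6)"
    then have "n = 0" using w assms by (simp; linarith)
    then show ?thesis using n by (simp add: complex_eq_iff)
  next
    assume n: "w = \<i> * of_real (of_int n - 1/6)"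
    then have "n = 1" using w assms by (simp; linarith)
    then show ?thesis using n by (simp add: complex_eq_iff)
  qed
next
  fix w assume "w \<in> {\<i> / 6, 5 * \<i> / 6}"
  then have "w = \<i> * of_real (of_int 0 + 1/6) \<or> w = \<i> * of_real (of_int 1 - 1/6)"
    by (auto simp: complex_eq_iff)
  then have "exp (2 * of_real pi * w) ^ 2 - exp (2 * of_real pi * w) + 1 = 0"
    unfolding sixth_root_equation by blast
  moreover have "Im w = 1 / 6 \<or> Im w = 5 / 6"
    using \<open>w \<in> _\<close> by (auto simp del: eq_divide_eq_numeral1)
  then have "0 < Im w - lam \<and> Im w - lam < 1" using assms by linarith
  ultimately show "w \<in> {w. gAB 1 2 (exp (2 * of_real pi * w)) = 1 \<and> 0 < Im w - lam \<and> Im w - lam < 1}"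
    by (simp add: gAB_1_2_eq_1_iff)
qed

lemma ee_eq_exp: "ee (of_real r) = exp (of_real (2 * pi * r) * \<i>)"
  by (simp add: ee_def mult_ac)

lemma minus_exp: "- exp z = exp (z + of_real pi * \<i>)"
  by (simp add: exp_add mult.commute)

text \<open>
  With \<open>Re Li2 = \<pi>^2 / 36\<close> the real parts of the Rogers values are \<open>- \<pi>^2 / 12\<close> and
  \<open>- 5 \<pi>^2 / 12\<close>; the imaginary parts are \<open>V / 2\<close> and \<open>- V / 2\<close>.
\<close>

lemma rogers_values:
  assumes V: "V = 2 * Im (Li2 (exp (of_real pi * \<i> / 3)))"
  shows "exp (\<i> * 2 / (2 * of_real pi) * Rogers (of_real pi * \<i> / 3) (exp (of_real pi * \<i> / 3)))
      = of_real (exp (- (V / (2 * pi)))) * ee (- 1 / 24)"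
    and "exp (\<i> * 2 / (2 * of_real pi) * Rogers (5 * of_real pi * \<i> / 3) (exp (- (of_real pi * \<i> / 3))))
      = - of_real (exp (V / (2 * pi))) * ee (- 1 / 24) * ee (1 / 3)"
proof -
  have e: "ee (- 1 / 24) = exp (of_real (2 * pi * (- 1 / 24)) * \<i>)" "ee (1 / 3) = exp (of_real (2 * pi * (1 / 3)) * \<i>)"
    using ee_eq_exp[of "- 1 / 24"] ee_eq_exp[of "1 / 3"] by simp_all
  note R = Rogers_def Li2_sixth_root[OF V] one_minus_exp_pi_third one_minus_exp_minus_pi_third Ln_exp_pi_third
  show "exp (\<i> * 2 / (2 * of_real pi) * Rogers (of_real pi * \<i> / 3) (exp (of_real pi * \<i> / 3)))
      = of_real (exp (- (V / (2 * pi)))) * ee (- 1 / 24)"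
    unfolding e exp_of_real[symmetric] exp_add[symmetric] R
    by (rule arg_cong[of _ _ exp]) (simp add: complex_eq_iff power2_eq_square field_simps)
  \<comment> \<open>the exponents of the two sides differ by \<open>2 \<pi> \<i>\<close> once the sign is written as \<open>exp (\<pi> \<i>)\<close>\<close>
  have "\<i> * 2 / (2 * of_real pi) * Rogers (5 * of_real pi * \<i> / 3) (exp (- (of_real pi * \<i> / 3)))
      = of_real (V / (2 * pi)) + of_real (2 * pi * (- 1 / 24)) * \<i> + of_real (2 * pi * (1 / 3)) * \<i>
        + of_real pi * \<i> - 2 * of_real pi * \<i>"
    unfolding R by (simp add: complex_eq_iff power2_eq_square field_simps)
  then have "exp (\<i> * 2 / (2 * of_real pi) * Rogers (5 * of_real pi * \<i> / 3) (exp (- (of_real pi * \<i> / 3))))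
      = - exp (of_real (V / (2 * pi)) + of_real (2 * pi * (- 1 / 24)) * \<i> + of_real (2 * pi * (1 / 3)) * \<i>)"
    unfolding minus_exp by (simp only: exp_diff exp_two_pi_i div_by_1)
  then show "exp (\<i> * 2 / (2 * of_real pi) * Rogers (5 * of_real pi * \<i> / 3) (exp (- (of_real pi * \<i> / 3))))
      = - of_real (exp (V / (2 * pi))) * ee (- 1 / 24) * ee (1 / 3)"
    unfolding e by (simp only: exp_add exp_of_real mult_minus_left)
qed

text \<open>
  The denominators \<open>(1 + z) / (1 - z)\<close> equal \<open>\<i> sqrt 3\<close> and \<open>- \<i> sqrt 3\<close>, and the principal square
  roots of \<open>1 - z\<close> are \<open>exp (- \<pi> \<i> / 6)\<close> and \<open>exp (\<pi> \<i> / 6)\<close>.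
\<close>

lemma prefactor_values:
  "exp (- (of_real pi * \<i> / 3)) powr (1 / 2) / (1 + 2 * exp (of_real pi * \<i> / 3) / exp (- (of_real pi * \<i> / 3)))
    = 1 / of_real (sqrt 3) * ee (- 1 / 3)"
  "exp (of_real pi * \<i> / 3) powr (1 / 2) / (1 + 2 * exp (- (of_real pi * \<i> / 3)) / exp (of_real pi * \<i> / 3))
    = 1 / of_real (sqrt 3) * ee (1 / 3)"
proof -
  have d1: "1 + 2 * exp (of_real pi * \<i> / 3) / exp (- (of_real pi * \<i> / 3)) = \<i> * of_real (sqrt 3)"
  proof -
    have "exp (- (of_real pi * \<i> / 3)) * (\<i> * of_real (sqrt 3)) = exp (- (of_real pi * \<i> / 3)) + 2 * exp (of_real pi * \<i> / 3)"
      unfolding exp_pi_third exp_minus_pi_third by (simp add: complex_eq_iff)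
    then show ?thesis by (simp add: field_simps)
  qed
  have d2: "1 + 2 * exp (- (of_real pi * \<i> / 3)) / exp (of_real pi * \<i> / 3) = - (\<i> * of_real (sqrt 3))"
  proof -
    have "exp (of_real pi * \<i> / 3) * (- (\<i> * of_real (sqrt 3))) = exp (of_real pi * \<i> / 3) + 2 * exp (- (of_real pi * \<i> / 3))"
      unfolding exp_pi_third exp_minus_pi_third by (simp add: complex_eq_iff)
    then show ?thesis by (simp add: field_simps)
  qed
  have i: "\<i> = exp (of_real (pi / 2) * \<i>)" using cis_pi_half by (simp add: cis_conv_exp mult.commute)
  have p1: "exp (- (of_real pi * \<i> / 3)) powr (1 / 2) = \<i> * ee (- 1 / 3)"
  proof -
    have "exp (- (of_real pi * \<i> / 3)) powr (1 / 2) = exp (- (of_real pi * \<i> / 6))"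
      by (simp add: powr_def Ln_exp_pi_third)
    also have "\<dots> = exp (of_real (pi / 2) * \<i> + of_real (2 * pi * (- 1 / 3)) * \<i>)"
      by (rule arg_cong[of _ _ exp]) (simp add: complex_eq_iff)
    also have "\<dots> = \<i> * ee (- 1 / 3)"
      using ee_eq_exp[of "- 1 / 3"] unfolding exp_add i[symmetric] by simp
    finally show ?thesis .
  qed
  have p2: "exp (of_real pi * \<i> / 3) powr (1 / 2) = - \<i> * ee (1 / 3)"
  proof -
    have "exp (of_real pi * \<i> / 3) powr (1 / 2) = exp (of_real pi * \<i> / 6)"
      by (simp add: powr_def Ln_exp_pi_third)
    also have "\<dots> = exp (of_real (2 * pi * (1 / 3)) * \<i> - of_real (pi / 2) * \<i>)"
      by (rule arg_cong[of _ _ exp]) (simp add: complex_eq_iff)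
    also have "\<dots> = - \<i> * ee (1 / 3)"
      using ee_eq_exp[of "1 / 3"] unfolding exp_diff i[symmetric] by (simp add: divide_i)
    finally show ?thesis .
  qed
  show "exp (- (of_real pi * \<i> / 3)) powr (1 / 2) / (1 + 2 * exp (of_real pi * \<i> / 3) / exp (- (of_real pi * \<i> / 3)))
    = 1 / of_real (sqrt 3) * ee (- 1 / 3)" unfolding d1 p1 by simp
  show "exp (of_real pi * \<i> / 3) powr (1 / 2) / (1 + 2 * exp (- (of_real pi * \<i> / 3)) / exp (of_real pi * \<i> / 3))
    = 1 / of_real (sqrt 3) * ee (1 / 3)" unfolding d2 p2 by simp
qed

theorem corollary1p3:
  fixes A B :: int and V C :: real and zp zm Rp Rm :: complex
  assumes A: "A = 1" and B: "B = 2"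
    and V: "V = 2 * Im (Li2 (exp (of_real pi * \<i> / 3)))"
    and C: "C = V / (2 * pi)"
    and zp: "zp = exp (2 * of_real pi * (\<i> / 6))"
    and zm: "zm = exp (2 * of_real pi * (5 * \<i> / 6))"
    and Rp: "Rp = Rogers (2 * of_real pi * \<i> / 6) zp"
    and Rm: "Rm = Rogers (10 * of_real pi * \<i> / 6) zm"
  shows "(2.0298832 \<le> V \<and> V < 2.0298833) \<and>
    (\<forall>z. gAB A B z = - z * (1 - z) powi (- 2)) \<and>
    (\<forall>\<^sub>F lam in at_left (0::real).
       {w. gAB A B (exp (2 * of_real pi * w)) = 1 \<and> 0 < Im w - lam \<and> Im w - lam < 1}
         = {\<i> / 6, 5 * \<i> / 6}) \<and>
    zp = ee (1 / 6) \<and>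
    zm = ee (- 1 / 6) \<and>
    exp (of_real pi * \<i> * (of_int B + 3 * of_int A - 6) / 12) = ee (- 1 / 24) \<and>
    exp (\<i> * of_int B / (2 * of_real pi) * Rp) = of_real (exp (- C)) * ee (- 1 / 24) \<and>
    exp (\<i> * of_int B / (2 * of_real pi) * Rm)
      = - of_real (exp C) * ee (- 1 / 24) * ee (1 / 3) \<and>
    (1 - zp) powr (of_int B / 4) / (of_int A + of_int B * zp / (1 - zp))
      = 1 / of_real (sqrt 3) * ee (- 1 / 3) \<and>
    (1 - zm) powr (of_int B / 4) / (of_int A + of_int B * zm / (1 - zm))
      = 1 / of_real (sqrt 3) * ee (1 / 3) \<and>
    (\<forall>\<^sub>F \<epsilon> in at_right (0::real).
       shifted_line_integrable \<epsilon> (\<lambda>x. Phi1 x ^ 2 * exp (- of_real pi * \<i> * x ^ 2)) \<and>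
       shifted_line_integral \<epsilon> (\<lambda>x. Phi1 x ^ 2 * exp (- of_real pi * \<i> * x ^ 2))
         = exp (of_real pi * \<i> / 6) / of_real (sqrt 3)
             * of_real (exp (V / (2 * pi)) - exp (- V / (2 * pi))))"
proof (intro conjI)
  have zp': "zp = exp (of_real pi * \<i> / 3)"
    unfolding zp by (rule arg_cong[of _ _ exp]) simp
  have zm': "zm = exp (- (of_real pi * \<i> / 3))"
    unfolding zm exp_eq by (rule exI[of _ 1]) (simp add: complex_eq_iff)
  have Rp': "Rp = Rogers (of_real pi * \<i> / 3) (exp (of_real pi * \<i> / 3))"
    unfolding Rp zp' by (rule arg_cong[of _ _ "\<lambda>l. Rogers l _"]) simp
  have Rm': "Rm = Rogers (5 * of_real pi * \<i> / 3) (exp (- (of_real pi * \<i> / 3)))"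
    unfolding Rm zm' by (rule arg_cong[of _ _ "\<lambda>l. Rogers l _"]) simp
  show "2.0298832 \<le> V" "V < 2.0298833" by (rule volume_bounds[OF V])+
  show "\<forall>z. gAB A B z = - z * (1 - z) powi (- 2)"
    unfolding A B by (simp only: gAB_1_2) blast
  show "\<forall>\<^sub>F lam in at_left (0::real).
      {w. gAB A B (exp (2 * of_real pi * w)) = 1 \<and> 0 < Im w - lam \<and> Im w - lam < 1} = {\<i> / 6, 5 * \<i> / 6}"
  proof -
    have "\<forall>\<^sub>F lam in at_left (0::real). lam \<in> {- (1 / 6)<..<0}"
      by (rule eventually_at_left_real) simp
    then show ?thesis
      by (rule eventually_mono) (unfold A B, rule gAB_1_2_solutions, auto)
  qed
  show "zp = ee (1 / 6)"
    unfolding zp' ee_def by (rule arg_cong[of _ _ exp]) simp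
  show "zm = ee (- 1 / 6)"
    unfolding zm' ee_def by (rule arg_cong[of _ _ exp]) simp
  show "exp (of_real pi * \<i> * (of_int B + 3 * of_int A - 6) / 12) = ee (- 1 / 24)"
    unfolding A B ee_def by (rule arg_cong[of _ _ exp]) simp
  show "exp (\<i> * of_int B / (2 * of_real pi) * Rp) = of_real (exp (- C)) * ee (- 1 / 24)"
    using rogers_values(1)[OF V] unfolding B Rp' C of_int_numeral .
  show "exp (\<i> * of_int B / (2 * of_real pi) * Rm) = - of_real (exp C) * ee (- 1 / 24) * ee (1 / 3)"
    using rogers_values(2)[OF V] unfolding B Rm' C of_int_numeral .
  show "(1 - zp) powr (of_int B / 4) / (of_int A + of_int B * zp / (1 - zp)) = 1 / of_real (sqrt 3) * ee (- 1 / 3)"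
    using prefactor_values(1) unfolding A B zp' one_minus_exp_pi_third by simp
  show "(1 - zm) powr (of_int B / 4) / (of_int A + of_int B * zm / (1 - zm)) = 1 / of_real (sqrt 3) * ee (1 / 3)"
    using prefactor_values(2) unfolding A B zm' one_minus_exp_minus_pi_third by simp
  show "\<forall>\<^sub>F \<epsilon> in at_right (0::real).
      shifted_line_integrable \<epsilon> (\<lambda>x. Phi1 x ^ 2 * exp (- of_real pi * \<i> * x ^ 2)) \<and>
      shifted_line_integral \<epsilon> (\<lambda>x. Phi1 x ^ 2 * exp (- of_real pi * \<i> * x ^ 2))
        = exp (of_real pi * \<i> / 6) / of_real (sqrt 3)
            * of_real (exp (V / (2 * pi)) - exp (- V / (2 * pi)))"
  proof -
    have "\<forall>\<^sub>F \<epsilon> in at_right (0::real). \<epsilon> \<in> {0<..<1 / 6}"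
      by (rule eventually_at_right_real) simp
    then show ?thesis
      by (rule eventually_mono) (use state_integral_41[OF V] in auto)
  qed
qed

end
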